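(* Fix an integer $z\ge1$. For $k\ge1$ let $P_z(k)$ be the proportion of integers $n\in[0,k^2+k)$ for which $N(n,k)=z$. Then $P_z(k)\to \frac{3}{\pi^2}\left(\frac{1}{z^2}+\frac{1}{(z+1)^2}\right)$ as $k\to\infty$.
   Context: For $n>k\ge1$, $N(n,k)$ is the nullity of the $n\times n$ skew-symmetric Toeplitz matrix $A(n,k)$ whose first $k$ superdiagonals have all entries $1$ and whose remaining superdiagonals have all entries $0$. This nullity depends only on $n\bmod (k^2+k)$, and $N(n,k)$ is defined for every integer $n$ as $N(n',k)$ for any $n'>k$ with $n'\equiv n\pmod{k^2+k}$. *)

theory Defs
  imports Complex_Main "Jordan_Normal_Form.Matrix_Kernel"
begin

definition toepA :: "nat \<Rightarrow> nat \<Rightarrow> real mat" where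
  "toepA n k = mat n n (\<lambda>(i,j).
      if i < j \<and> j - i \<le> k then 1
      else if j < i \<and> i - j \<le> k then -1
      else 0)"

text \<open>Nullity N(n,k) for n > k is the kernel dimension of A(n,k); for n <= k it is defined
  through the representative n + (k^2+k) > k of the same residue class mod k^2+k.\<close>
definition nullN :: "nat \<Rightarrow> nat \<Rightarrow> nat" where
  "nullN n k = (if n > k then kernel_dim (toepA n k)
                else kernel_dim (toepA (n + (k^2 + k)) k))"

definition propP :: "nat \<Rightarrow> nat \<Rightarrow> real" where
  "propP z k = real (card {n \<in> {0..<k^2 + k}. nullN n k = z}) / real (k^2 + k)"

end

theory Submission
  imports
    "HOL-Analysis.Gamma_Function"
    "HOL-Computational_Algebra.Field_as_Ring"
    "HOL-Computational_Algebra.Polynomial_Factorial"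
    "HOL-Number_Theory.Totient"
    Defs
begin

text \<open>
  A kernel vector of \<open>A(n,k)\<close>, read as a polynomial, becomes after multiplication by
  \<open>B = (1 - x^(k+1)) (1 + \<dots> + x^(k-1))\<close> a polynomial without coefficients in the degrees
  \<open>k, \<dots>, n+k-1\<close>. So the kernel consists of the pairs \<open>(p, q)\<close> of degree less than \<open>k\<close> for which
  \<open>B\<close> divides \<open>x^(n+k) p - q\<close>, and \<open>n\<close> matters only modulo \<open>k^2 + k\<close>.

  For every reduced fraction \<open>j/h\<close> in \<open>(0, 1]\<close> with \<open>h \<le> k\<close> put \<open>G = k div h\<close> and let \<open>E(j/h)\<close> be
  the sum of \<open>\<lfloor>y j / h\<rfloor> + \<lceil>y j / h\<rceil>\<close> over \<open>1 \<le> y \<le> k\<close>. At the exponent \<open>E(j/h)\<close> there is an explicit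
  solution of degree \<open>k - G\<close>. Any other solution has constant coefficients along the support of this
  one, which contains both \<open>0\<close> and \<open>k - G\<close>, so no nonzero solution has smaller degree. Hence the
  nullity is \<open>G - \<bar>t\<bar>\<close> if \<open>n + k\<close> is congruent to \<open>E(j/h) + t\<close> with \<open>\<bar>t\<bar> \<le> G\<close>. The intervals
  \<open>-G < t \<le> G\<close> around the numbers \<open>E(j/h)\<close> are disjoint, and since the sum of \<open>\<phi>(h) (k div h)\<close>
  over \<open>h \<le> k\<close> is \<open>k (k + 1) / 2\<close>, they fill all residues modulo \<open>k^2 + k\<close>.
  So exactly \<open>\<Phi>(k div z) + \<Phi>(k div (z + 1))\<close> residues have nullity \<open>z\<close>, where \<open>\<Phi>\<close> is the
  summatory function of the totient, which satisfies \<open>\<Phi>(m) \<sim> 3 m^2 / \<pi>^2\<close>.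
\<close>

section \<open>The dimension of a matrix kernel\<close>

text \<open>Independence and generation are stated coordinatewise for an indexed family, so that
  they can be checked on polynomial coefficients. Two equal members would violate independence,
  hence the image of \<open>b\<close> has exactly \<open>z\<close> elements.\<close>

lemma kernel_dim_eqI:
  fixes A :: "'a :: field mat" and b :: "nat \<Rightarrow> 'a vec"
  assumes A: "A \<in> carrier_mat nr nc"
    and ker: "\<And>i. i < z \<Longrightarrow> b i \<in> mat_kernel A"
    and indep: "\<And>c. (\<And>j. j < nc \<Longrightarrow> (\<Sum>i<z. c i * vec_index (b i) j) = 0) \<Longrightarrow> (\<And>i. i < z \<Longrightarrow> c i = 0)"
    and gen: "\<And>v. v \<in> mat_kernel A \<Longrightarrow> \<exists>c. \<forall>j<nc. vec_index v j = (\<Sum>i<z. c i * vec_index (b i) j)"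
  shows "kernel_dim A = z"
proof -
  interpret kernel nr nc A by unfold_locales (rule A)
  let ?B = "b ` {..<z}"
  have inj: "inj_on b {..<z}"
  proof (rule inj_onI, rule ccontr)
    fix i i' assume ii: "i \<in> {..<z}" "i' \<in> {..<z}" "b i = b i'" "i \<noteq> i'"
    let ?c = "\<lambda>l. if l = i then 1 else if l = i' then - 1 else (0::'a)"
    have "(\<Sum>l<z. ?c l * vec_index (b l) j) = 0" for j
    proof -
      have "(\<Sum>l<z. ?c l * vec_index (b l) j) = (\<Sum>l\<in>{i,i'}. ?c l * vec_index (b l) j)"
        by (rule sum.mono_neutral_right) (use ii in auto)
      also have "\<dots> = 0" using ii by simp
      finally show ?thesis .
    qed
    from indep[of ?c, OF this, of i] ii show False by auto
  qed
  have sub: "?B \<subseteq> mat_kernel A" using ker by auto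
  have reind: "(\<Sum>x\<in>?B. a x * vec_index x j) = (\<Sum>i<z. a (b i) * vec_index (b i) j)" for a j
    by (subst sum.reindex[OF inj]) simp
  have li: "\<not> Ker.lin_dep ?B"
  proof (rule Ker.finite_lin_indpt2)
    show "finite ?B" "?B \<subseteq> mat_kernel A" using sub by auto
    fix a :: "'a vec \<Rightarrow> 'a" assume "lincomb a ?B = 0\<^sub>v nc"
    hence "(\<Sum>i<z. a (b i) * vec_index (b i) j) = 0" if "j < nc" for j
      using lincomb_index[OF that sub, of a] that by (simp add: reind)
    from indep[of "\<lambda>i. a (b i)", OF this] show "\<forall>v\<in>?B. a v = 0" by auto
  qed
  have gs: "mat_kernel A \<subseteq> span ?B"
  proof
    fix v assume v: "v \<in> mat_kernel A"
    from gen[OF v] obtain c where c: "\<forall>j<nc. vec_index v j = (\<Sum>i<z. c i * vec_index (b i) j)" by auto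
    define a where "a x = c (the_inv_into {..<z} b x)" for x
    have ab: "a (b i) = c i" if "i < z" for i
      unfolding a_def using the_inv_into_f_f[OF inj, of i] that by simp
    have cl: "lincomb a ?B \<in> mat_kernel A" using sub by (intro Ker.lincomb_closed) auto
    have "v = lincomb a ?B"
    proof (rule eq_vecI)
      show "dim_vec v = dim_vec (lincomb a ?B)"
        using mat_kernelD(1)[OF A v] mat_kernelD(1)[OF A cl] by auto
      fix j assume "j < dim_vec (lincomb a ?B)"
      hence j: "j < nc" using mat_kernelD(1)[OF A cl] by auto
      show "vec_index v j = vec_index (lincomb a ?B) j"
        unfolding lincomb_index[OF j sub] reind using c j ab by auto
    qed
    thus "v \<in> span ?B" unfolding Ker.span_def by blast
  qed
  have "Ker.basis ?B"
    unfolding Ker.basis_def using li gs sub Ker.span_is_subset2[OF sub] by auto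
  hence "dim = card ?B" by (intro Ker.dim_basis) auto
  thus ?thesis by (simp add: card_image[OF inj])
qed

section \<open>The band polynomial\<close>

definition geom_poly :: "nat \<Rightarrow> real poly" where
  "geom_poly k = (\<Sum>i<k. monom 1 i)"

text \<open>This is the symbol of the Toeplitz matrix, the sum of \<open>x^(-s) - x^s\<close> over
  \<open>1 \<le> s \<le> k\<close>, multiplied by \<open>x^k\<close>.\<close>

definition band_poly :: "nat \<Rightarrow> real poly" where
  "band_poly k = (1 - monom 1 (k + 1)) * geom_poly k"

lemma coeff_geom_poly: "coeff (geom_poly k) i = (if i < k then 1 else 0)"
  by (simp add: geom_poly_def coeff_sum)

lemma geom_poly_mult: "(monom 1 1 - 1) * geom_poly k = monom 1 k - 1"
  by (induction k) (simp_all add: geom_poly_def algebra_simps mult_monom)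

lemma degree_geom_poly: "degree (geom_poly k) = k - 1"
proof (cases k)
  case (Suc m)
  show ?thesis unfolding Suc
    by (intro antisym degree_le le_degree) (auto simp: coeff_geom_poly)
qed (simp add: geom_poly_def)

text \<open>A common divisor divides \<open>x^k - 1\<close> and \<open>x^(k+1) - 1\<close>, hence
  \<open>x - 1\<close>. Modulo \<open>x - 1\<close> the geometric sum is the constant
  \<open>k\<close>, a unit.\<close>

lemma coprime_band_factors:
  assumes "k \<ge> 1"
  shows "coprime (monom 1 (k + 1) - 1) (geom_poly k)"
proof (rule coprimeI)
  fix d assume d: "d dvd monom 1 (k + 1) - 1" "d dvd geom_poly k"
  have "d dvd monom 1 k - 1"
    using d(2) geom_poly_mult[of k] by (metis dvd_mult)
  hence "d dvd (monom 1 (k + 1) - 1) - monom 1 1 * (monom 1 k - 1)"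
    by (rule dvd_diff[OF d(1) dvd_mult])
  also have "\<dots> = (monom 1 1 - 1 :: real poly)"
    by (simp add: algebra_simps mult_monom)
  finally have d1: "d dvd (monom 1 1 - 1)" .
  have "d dvd (\<Sum>i<k. monom 1 i - 1)"
    using d1 geom_poly_mult by (intro dvd_sum) (metis dvd_mult2)
  hence "d dvd geom_poly k - (\<Sum>i<k. monom 1 i - 1)" using d(2) by (rule dvd_diff[rotated])
  also have "\<dots> = of_nat k" by (simp add: geom_poly_def sum_subtractf)
  finally have "d dvd [:real k:]" by (simp add: of_nat_poly)
  moreover have "[:real k:] dvd 1" using assms by (simp add: is_unit_const_poly_iff dvd_field_iff)
  ultimately show "is_unit d" using dvd_trans by blast
qed

lemma monom_minus_one_dvd:
  assumes "[a = b] (mod m)"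
  shows "monom 1 m - 1 dvd (monom 1 a - monom 1 b :: 'a :: comm_ring_1 poly)"
proof -
  have *: "monom 1 m - 1 dvd (monom 1 (b + m * c) - monom 1 b :: 'a poly)" for b c
  proof (induction c)
    case (Suc c)
    have "monom 1 (b + m * Suc c) - monom 1 b
        = monom 1 (b + m * c) * (monom 1 m - 1) + (monom 1 (b + m * c) - monom 1 b :: 'a poly)"
      by (simp add: algebra_simps mult_monom)
    thus ?case using Suc by (metis dvd_add dvd_triv_right)
  qed simp
  show ?thesis
  proof (cases "a \<le> b")
    case True
    then obtain c where "b = a + m * c"
      using assms by (metis cong_def mod_eq_nat1E)
    hence "monom 1 a - monom 1 b = - (monom 1 (a + m * c) - monom 1 a :: 'a poly)" by simp
    thus ?thesis using *[of a c] by (simp only: dvd_minus_iff)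
  next
    case False
    then obtain c where "a = b + m * c"
      using assms by (metis cong_def mod_eq_nat1E nat_le_linear)
    thus ?thesis using *[of b c] by simp
  qed
qed

lemma band_poly_alt: "band_poly k = - ((monom 1 (k + 1) - 1) * geom_poly k)"
  by (simp add: band_poly_def algebra_simps)

lemma band_poly_dvd_iff:
  assumes "k \<ge> 1"
  shows "band_poly k dvd f \<longleftrightarrow> monom 1 (k + 1) - 1 dvd f \<and> geom_poly k dvd f"
  unfolding band_poly_alt minus_dvd_iff
  using coprime_band_factors[OF assms] by (auto intro: divides_mult dest: dvd_mult_left dvd_mult_right)

text \<open>Replacing \<open>geom_poly k\<close> by its multiple \<open>x^k - 1\<close> gives both
  hypotheses the form \<open>x^m - 1\<close>, for which congruences between exponents
  suffice.\<close>

lemma band_poly_dvdI: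
  assumes "k \<ge> 1" "monom 1 (k + 1) - 1 dvd f" "monom 1 k - 1 dvd f"
  shows "band_poly k dvd f"
  using assms geom_poly_mult[of k] by (metis band_poly_dvd_iff dvd_mult_right)

text \<open>Both \<open>k\<close> and \<open>k + 1\<close> divide \<open>k^2 + k\<close>; this is
  why exponents matter only modulo \<open>k^2 + k\<close>.\<close>

lemma band_poly_dvd_monom_diff:
  assumes k: "k \<ge> 1" and cong: "[a = b] (mod (k^2 + k))"
  shows "band_poly k dvd monom 1 a - monom 1 b"
proof (rule band_poly_dvdI[OF k])
  have "k\<^sup>2 + k = (k + 1) * k" "k\<^sup>2 + k = k * (k + 1)" by (simp_all add: power2_eq_square)
  thus "monom 1 (k + 1) - 1 dvd (monom 1 a - monom 1 b :: real poly)"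
       "monom 1 k - 1 dvd (monom 1 a - monom 1 b :: real poly)"
    using cong by (metis monom_minus_one_dvd cong_modulus_mult_nat)+
qed

lemma coeff_band_poly:
  "coeff (band_poly k) t = (if t < k then 1 else if k < t \<and> t \<le> 2 * k then - 1 else 0)"
proof -
  have "band_poly k = geom_poly k - monom 1 (k + 1) * geom_poly k"
    by (simp add: band_poly_def algebra_simps)
  thus ?thesis by (auto simp: coeff_monom_mult coeff_geom_poly)
qed

lemma degree_band_poly:
  assumes "k \<ge> 1" shows "degree (band_poly k) = 2 * k"
  by (intro antisym degree_le le_degree) (use assms in \<open>auto simp: coeff_band_poly\<close>)

lemma band_poly_nonzero: "k \<ge> 1 \<Longrightarrow> band_poly k \<noteq> 0"
  using degree_band_poly by force

lemma coprime_monom_one: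
  fixes p :: "'a :: field_gcd poly"
  assumes "coeff p 0 \<noteq> 0"
  shows "coprime (monom 1 n) p"
proof -
  have "prime_elem [:0, 1 :: 'a:]" by (rule prime_elem_linear_field_poly) simp
  moreover have "\<not> [:0, 1:] dvd p"
    using assms by (metis dvd_iff_poly_eq_0 neg_0_equal_iff_equal poly_0_coeff_0)
  ultimately have "coprime [:0, 1:] p" by (rule prime_elem_imp_coprime)
  thus ?thesis by (simp add: monom_altdef)
qed

section \<open>Remainders modulo \<open>x^m - 1\<close> as cyclic shifts of the coefficients\<close>

definition cyclic_shift :: "nat \<Rightarrow> nat \<Rightarrow> 'a poly \<Rightarrow> 'a :: comm_ring_1 poly" where
  "cyclic_shift m e p = (\<Sum>i<m. monom (coeff p i) ((i + e) mod m))"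

lemma poly_as_sum_less:
  assumes "\<forall>i\<ge>m. coeff p i = 0"
  shows "p = (\<Sum>i<m. monom (coeff p i) i)"
  by (rule poly_eqI) (use assms in \<open>auto simp: coeff_sum not_less\<close>)

lemma monom_minus_one_dvd_cyclic_shift:
  assumes "\<forall>i\<ge>m. coeff p i = 0"
  shows "monom 1 m - 1 dvd monom 1 e * p - cyclic_shift m e p"
proof -
  have "monom 1 e * p - cyclic_shift m e p
      = (\<Sum>i<m. monom 1 e * monom (coeff p i) i - monom (coeff p i) ((i + e) mod m))"
    by (subst poly_as_sum_less[OF assms]) (simp add: cyclic_shift_def sum_distrib_left sum_subtractf)
  also have "\<dots> = (\<Sum>i<m. [:coeff p i:] * (monom 1 (i + e) - monom 1 ((i + e) mod m)))"
    by (intro sum.cong) (simp_all add: mult_monom smult_monom smult_diff_right add.commute)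
  also have "monom 1 m - 1 dvd \<dots>"
    by (intro dvd_sum dvd_mult monom_minus_one_dvd) (simp add: cong_def)
  finally show ?thesis .
qed

lemma coeff_cyclic_shift:
  assumes "i < m" "i' < m" "[i' = i + e] (mod m)"
  shows "coeff (cyclic_shift m e p) i' = coeff p i"
proof -
  have "(l + e) mod m = i' \<longleftrightarrow> l = i" if "l < m" for l
    using assms that by (metis cong_add_rcancel_nat cong_def mod_less)
  hence "coeff (cyclic_shift m e p) i' = (\<Sum>l<m. if l = i then coeff p l else 0)"
    unfolding cyclic_shift_def coeff_sum coeff_monom by (intro sum.cong) auto
  thus ?thesis using assms(1) by simp
qed

lemma coeff_cyclic_shift_eq_0:
  assumes "0 < m" "m \<le> i"
  shows "coeff (cyclic_shift m e p) i = 0"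
proof -
  have "(l + e) mod m \<noteq> i" for l
    using mod_less_divisor[of m "l + e"] assms by linarith
  thus ?thesis by (simp add: cyclic_shift_def coeff_sum)
qed

text \<open>\<open>q\<close> and the cyclic shift of \<open>p\<close> are congruent modulo
  \<open>x^m - 1\<close> and both have degree less than \<open>m\<close>, so they coincide.\<close>

lemma coeff_eq_if_monom_minus_one_dvd:
  fixes p q :: "real poly"
  assumes dvd: "monom 1 m - 1 dvd monom 1 e * p - q"
    and p: "\<forall>i\<ge>m. coeff p i = 0" and q: "\<forall>i\<ge>m. coeff q i = 0"
    and i: "i < m" "i' < m" "[i' = i + e] (mod m)"
  shows "coeff q i' = coeff p i"
proof -
  let ?s = "cyclic_shift m e p"
  have "monom 1 m - 1 dvd (monom 1 e * p - q) - (monom 1 e * p - ?s)"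
    by (intro dvd_diff dvd monom_minus_one_dvd_cyclic_shift p)
  hence *: "monom 1 m - 1 dvd ?s - q" by simp
  have "?s - q = 0"
  proof (rule ccontr)
    assume nz: "?s - q \<noteq> 0"
    have "degree (monom 1 m - 1 :: real poly) \<le> degree (?s - q)"
      by (rule dvd_imp_degree_le[OF * nz])
    moreover have "m \<le> degree (monom 1 m - 1 :: real poly)"
      using i by (intro le_degree) auto
    ultimately have "coeff (?s - q) (degree (?s - q)) = 0"
      using i q by (simp add: coeff_cyclic_shift_eq_0)
    thus False using nz leading_coeff_0_iff by blast
  qed
  thus ?thesis using coeff_cyclic_shift[OF i, of p] by simp
qed

text \<open>A congruence modulo a polynomial of degree \<open>k - 1\<close> leaves a scalar multiple
  of \<open>geom_poly k\<close> undetermined among the polynomials of degree less than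
  \<open>k\<close>. Its coefficients are all 1, hence the additive constant
  \<open>c\<close>.\<close>

lemma coeff_eq_if_geom_poly_dvd:
  assumes dvd: "geom_poly k dvd monom 1 e * p - q"
    and p: "\<forall>i\<ge>k. coeff p i = 0" and q: "\<forall>i\<ge>k. coeff q i = 0"
  obtains c where "\<And>i i'. i < k \<Longrightarrow> i' < k \<Longrightarrow> [i' = i + e] (mod k) \<Longrightarrow> coeff q i' = coeff p i + c"
proof (cases "k = 0")
  case False
  let ?s = "cyclic_shift k e p"
  have "geom_poly k dvd monom 1 k - 1" using geom_poly_mult[of k] by (metis dvd_triv_right)
  hence "geom_poly k dvd monom 1 e * p - ?s"
    using monom_minus_one_dvd_cyclic_shift[OF p] by (rule dvd_trans)
  hence "geom_poly k dvd (monom 1 e * p - ?s) - (monom 1 e * p - q)"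
    by (rule dvd_diff[OF _ dvd])
  then obtain w where w: "q - ?s = geom_poly k * w" by (auto elim: dvdE)
  have g0: "geom_poly k \<noteq> 0" using False by (metis coeff_0 coeff_geom_poly neq0_conv zero_neq_one)
  have "degree w = 0"
  proof (cases "w = 0")
    case nz: False
    have "degree (q - ?s) = k - 1 + degree w"
      unfolding w by (simp add: degree_mult_eq nz g0 degree_geom_poly)
    moreover have "coeff (q - ?s) i = 0" if "i \<ge> k" for i
      using that False q by (simp add: coeff_cyclic_shift_eq_0)
    moreover have "q - ?s \<noteq> 0" using w nz g0 by simp
    ultimately have "k - 1 + degree w < k" by (metis leading_coeff_0_iff not_le)
    thus ?thesis by simp
  qed simp
  then obtain c where c: "w = [:c:]" by (metis degree_0_id)
  show ?thesis
  proof (rule that)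
    fix i i' assume i: "i < k" "i' < k" "[i' = i + e] (mod k)"
    have "coeff (q - ?s) i' = c" unfolding w c using i by (simp add: coeff_geom_poly)
    thus "coeff q i' = coeff p i + c" using coeff_cyclic_shift[OF i, of p] by simp
  qed
qed (use that in auto)

section \<open>Level and peak sums\<close>

text \<open>For \<open>0 \<le> l < h\<close> the level counts the \<open>y \<in> {1..k}\<close> with \<open>0 < - y j mod h \<le> l\<close>. The levels are the
  exponents of the explicit solution. The extension to all integers \<open>l\<close> makes them
  quasi-periodic, which turns a rotation of the index into a shift modulo \<open>k\<close> or \<open>k + 1\<close>.\<close>

definition level :: "nat \<Rightarrow> int \<Rightarrow> int \<Rightarrow> int \<Rightarrow> int" where
  "level k h j l = (\<Sum>y=1..int k. (y * j + l) div h - y * j div h)"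

definition peak :: "nat \<Rightarrow> int \<Rightarrow> int \<Rightarrow> int" where
  "peak k h j = (\<Sum>y=1..int k. y * j div h - (- (y * j)) div h)"

lemma level_0 [simp]: "level k h j 0 = 0"
  by (simp add: level_def)

lemma level_mono:
  assumes "h > 0" "l \<le> l'"
  shows "level k h j l \<le> level k h j l'"
  unfolding level_def using assms by (intro sum_mono diff_mono zdiv_mono1) auto

lemma level_add_mult:
  assumes "h > 0"
  shows "level k h j (l + h * d) = level k h j l + int k * d"
proof -
  have "(y * j + (l + h * d)) div h = (y * j + l) div h + d" for y
    using assms by (metis add.assoc add.commute div_mult_self2 less_irrefl)
  thus ?thesis by (simp add: level_def sum.distrib sum_subtractf algebra_simps)
qed

lemma card_multiples_int:
  assumes "h > 0"
  shows "card {y \<in> {1..int k}. h dvd y} = nat (int k div h)"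
proof -
  have "{y \<in> {1..int k}. h dvd y} = (\<lambda>i. h * i) ` {1..int k div h}"
  proof (intro equalityI subsetI)
    fix y assume y: "y \<in> {y \<in> {1..int k}. h dvd y}"
    then obtain i where i: "y = h * i" by auto
    have "i \<ge> 1" using y i assms by (simp add: zero_less_mult_iff int_one_le_iff_zero_less)
    moreover have "i \<le> int k div h"
      using y i assms by (metis (no_types, lifting) atLeastAtMost_iff mem_Collect_eq
          nonzero_mult_div_cancel_left less_irrefl zdiv_mono1)
    ultimately show "y \<in> (\<lambda>i. h * i) ` {1..int k div h}" using i by auto
  next
    fix y assume "y \<in> (\<lambda>i. h * i) ` {1..int k div h}"
    then obtain i where i: "y = h * i" "1 \<le> i" "i \<le> int k div h" unfolding image_iff by fastforce
    have "h * i \<le> h * (int k div h)" using i assms by (intro mult_left_mono) auto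
    also have "\<dots> \<le> int k" using assms by (simp add: minus_mod_eq_mult_div [symmetric])
    finally have "h * i \<le> int k" .
    moreover have "1 \<le> h * i" using i assms by (metis int_one_le_iff_zero_less mult_pos_pos)
    ultimately show "y \<in> {y \<in> {1..int k}. h dvd y}" using i by simp
  qed
  moreover have "inj_on (\<lambda>i. h * i) {1..int k div h}" using assms by (auto simp: inj_on_def)
  ultimately show ?thesis by (simp add: card_image)
qed

lemma div_diff_pred:
  fixes a h :: int
  assumes "h > 0"
  shows "a div h - (a - 1) div h = (if h dvd a then 1 else 0)"
proof -
  have "(a - 1) div h = a div h" if "\<not> h dvd a"
  proof -
    have "a mod h > 0" "a mod h < h"
      using that assms pos_mod_bound[of h a] pos_mod_sign[of h a]
      by (auto simp: dvd_eq_mod_eq_0 order_less_le)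
    moreover have "a - 1 = h * (a div h) + (a mod h - 1)" by simp
    ultimately show ?thesis
      using int_div_pos_eq[of "a - 1" h "a div h" "a mod h - 1"] by simp
  qed
  moreover have "(a - 1) div h = a div h - 1" if "h dvd a"
  proof -
    from that obtain c where c: "a = h * c" by auto
    have "a - 1 = h * (c - 1) + (h - 1)" using c by (simp add: algebra_simps)
    hence "(a - 1) div h = c - 1" using assms int_div_pos_eq[of "a - 1" h "c - 1" "h - 1"] by simp
    thus ?thesis using c assms by simp
  qed
  ultimately show ?thesis by simp
qed

text \<open>The level at \<open>h\<close> is \<open>k\<close>. Going from \<open>h - 1\<close> to
  \<open>h\<close> gains one for each \<open>y\<close> with \<open>h dvd y * j\<close>, which by
  coprimality means \<open>h dvd y\<close>.\<close>

lemma level_top: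
  assumes h: "h > 0" and "coprime j h"
  shows "level k h j (h - 1) = int k - int k div h"
proof -
  have "level k h j h - level k h j (h - 1)
      = (\<Sum>y=1..int k. (y * j + h) div h - (y * j + h - 1) div h)"
    by (simp add: level_def sum_subtractf algebra_simps)
  also have "\<dots> = (\<Sum>y=1..int k. if h dvd y then 1 else 0)"
    using assms by (intro sum.cong refl)
      (simp only: div_diff_pred dvd_add_triv_right_iff coprime_dvd_mult_left_iff coprime_commute)
  also have "\<dots> = int (card {y \<in> {1..int k}. h dvd y})"
    by (simp add: sum.If_cases Int_def conj_commute)
  also have "\<dots> = int k div h" using h by (subst card_multiples_int) (auto simp: pos_imp_zdiv_nonneg_iff)
  finally show ?thesis using level_add_mult[OF h, of k j 0 1] by simp
qed

text \<open>The substitution \<open>y -> k + 1 - y\<close> exchanges \<open>- j\<close> and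
  \<open>j\<close> and translates \<open>l\<close> by \<open>(k + 1) * j\<close>. The parts of the
  two levels that are free of \<open>l\<close> differ by the peak sum.\<close>

lemma level_reflect:
  "level k h (- j) l = level k h j (l - (int k + 1) * j) + peak k h j"
proof -
  have "(\<Sum>y=1..int k. (y * (- j) + l) div h) = (\<Sum>y=1..int k. (y * j + (l - (int k + 1) * j)) div h)"
    by (rule sum.reindex_bij_witness[of _ "\<lambda>y. int k + 1 - y" "\<lambda>y. int k + 1 - y"])
       (auto simp: algebra_simps)
  thus ?thesis by (simp add: level_def peak_def sum_subtractf)
qed

text \<open>With \<open>y = 0\<close> included, the substitution \<open>y -> k - y\<close>
  translates \<open>l\<close> by \<open>k * j\<close> only; the summands at 0 are the extra
  quotients by \<open>h\<close>.\<close>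

lemma level_reflect':
  "level k h (- j) l + l div h = level k h j (l - int k * j) + (l - int k * j) div h + peak k h j"
proof -
  have ins: "{0..int k} = insert 0 {1..int k}" by auto
  have "(\<Sum>y=0..int k. (y * (- j) + l) div h) = (\<Sum>y=0..int k. (y * j + (l - int k * j)) div h)"
    by (rule sum.reindex_bij_witness[of _ "\<lambda>y. int k - y" "\<lambda>y. int k - y"])
       (auto simp: algebra_simps)
  thus ?thesis by (simp add: level_def peak_def sum_subtractf ins)
qed

lemma level_cong:
  assumes "h > 0"
  shows "[level k h (- j) l = level k h j ((l - (int k + 1) * j) mod h) + peak k h j] (mod int k)"
proof -
  let ?l = "l - (int k + 1) * j"
  have "level k h j ?l = level k h j (?l mod h) + int k * (?l div h)"
    using level_add_mult[OF assms, of k j "?l mod h" "?l div h"] by simp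
  thus ?thesis unfolding level_reflect by (simp add: cong_def add.assoc add.left_commute)
qed

lemma level_cong':
  assumes "0 \<le> l" "l < h"
  shows "[level k h (- j) l = level k h j ((l - int k * j) mod h) + peak k h j] (mod (int k + 1))"
proof -
  let ?l = "l - int k * j"
  have "level k h j ?l = level k h j (?l mod h) + int k * (?l div h)"
    using level_add_mult[of h k j "?l mod h" "?l div h"] assms by simp
  moreover have "l div h = 0" using assms by simp
  ultimately have "level k h (- j) l
      = level k h j (?l mod h) + peak k h j + (int k + 1) * (?l div h)"
    using level_reflect'[of k h j l] by (simp add: algebra_simps)
  thus ?thesis by (simp only: cong_def mod_mult_self2)
qed

section \<open>Values and separation of the peaks\<close>

lemma peak_one: "peak k 1 1 = int (k^2 + k)"
proof -
  have "(\<Sum>y=1..int k. 2 * y) = int k ^ 2 + int k"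
  proof (induction k)
    case (Suc k)
    have "{1..int (Suc k)} = insert (int k + 1) {1..int k}" by auto
    thus ?case using Suc by (simp add: power2_eq_square algebra_simps)
  qed simp
  thus ?thesis by (simp add: peak_def)
qed

lemma peak_zero: "peak k h 0 = 0"
  by (simp add: peak_def)

text \<open>Passing from \<open>j / h\<close> to a larger fraction \<open>j' / h'\<close> raises \<open>\<lfloor>y j / h\<rfloor>\<close> whenever \<open>h'\<close> divides \<open>y\<close>,
  and \<open>\<lceil>y j / h\<rceil>\<close> whenever \<open>h\<close> divides \<open>y\<close>.\<close>

lemma peak_diff_ge:
  assumes h: "h > 0" "h' > 0" and less: "j * h' < j' * h"
  shows "peak k h' j' - peak k h j \<ge> int k div h + int k div h'"
proof -
  have floor: "a' * y div h' - a * y div h \<ge> (if h' dvd y then 1 else 0)"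
    if y: "y > 0" and h: "h > 0" "h' > 0" and less: "a * h' < a' * h" for y a a' h h' :: int
  proof -
    have "a * y div h \<le> a' * y div h'"
    proof -
      have "h * (a * y div h) \<le> a * y" using h by (simp add: minus_mod_eq_mult_div [symmetric])
      hence "h' * (h * (a * y div h)) \<le> h' * (a * y)" using h by (intro mult_left_mono) auto
      also have "\<dots> = y * (a * h')" by (simp add: algebra_simps)
      also have "\<dots> \<le> y * (a' * h)" using less y by (intro mult_left_mono) auto
      finally have "h * (h' * (a * y div h)) \<le> h * (a' * y)" by (simp add: algebra_simps)
      hence "h' * (a * y div h) \<le> a' * y" using h by simp
      thus ?thesis using h by (metis zdiv_mono1 nonzero_mult_div_cancel_left less_irrefl)
    qed
    moreover have "a * y div h < a' * y div h'" if "h' dvd y"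
    proof -
      from that obtain c where c: "y = h' * c" by auto
      have c0: "c > 0" using c y h by (simp add: zero_less_mult_iff)
      have "a' * y div h' = a' * c" using h by (simp add: c)
      moreover have "a * y < a' * c * h"
      proof -
        have "a * y = (a * h') * c" by (simp add: c)
        also have "\<dots> < (a' * h) * c" using less c0 by simp
        finally show ?thesis by (simp add: algebra_simps)
      qed
      hence "a * y div h < a' * c"
        using h zdiv_mono1[of "a' * c * h" "a * y" h]
        by (smt (verit) minus_mod_eq_div_mult mult_less_cancel_right pos_mod_sign)
      ultimately show ?thesis by simp
    qed
    ultimately show ?thesis by (cases "h' dvd y") (simp_all add: int_one_le_iff_zero_less)
  qed
  \<comment> \<open>A ceiling is a negated floor at the negated fraction, so the same estimate
    serves for both, with \<open>h\<close> and \<open>h'\<close> exchanged.\<close>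
  have summand: "(y * j' div h' - (- (y * j')) div h') - (y * j div h - (- (y * j)) div h)
      \<ge> (if h' dvd y then 1 else 0) + (if h dvd y then 1 else 0)" if "y \<in> {1..int k}" for y
    using floor[of y h h' j j'] floor[of y h' h "- j'" "- j"] that h less
    by (simp add: mult.commute)
  have cnt: "(\<Sum>y=1..int k. if m dvd y then 1 else 0) = int k div m" if "m > 0" for m :: int
  proof -
    have "(\<Sum>y=1..int k. if m dvd y then 1 else 0) = int (card {y \<in> {1..int k}. m dvd y})"
      by (simp add: sum.If_cases Int_def conj_commute)
    thus ?thesis using that by (subst (asm) card_multiples_int) (auto simp: pos_imp_zdiv_nonneg_iff)
  qed
  have "int k div h' + int k div h
      = (\<Sum>y=1..int k. (if h' dvd y then 1 else 0) + (if h dvd y then 1 else 0))"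
    using h by (simp add: sum.distrib cnt)
  also have "\<dots> \<le> (\<Sum>y=1..int k. (y * j' div h' - (- (y * j')) div h') - (y * j div h - (- (y * j)) div h))"
    by (rule sum_mono) (rule summand)
  also have "\<dots> = peak k h' j' - peak k h j" by (simp add: peak_def sum_subtractf)
  finally show ?thesis by simp
qed

section \<open>Explicit solutions at a peak\<close>

text \<open>Different \<open>l\<close> may give the same exponent, so the coefficients count
  multiplicities. Together with \<open>level_poly k h (- j)\<close> this is the explicit solution at
  the peak of \<open>j / h\<close>.\<close>

definition level_poly :: "nat \<Rightarrow> int \<Rightarrow> int \<Rightarrow> real poly" where
  "level_poly k h j = (\<Sum>l\<in>{0..<h}. monom 1 (nat (level k h j l)))"

lemma level_bounds:
  assumes "0 \<le> l" "l < h" "coprime j h"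
  shows "0 \<le> level k h j l" "level k h j l \<le> int k - int k div h"
proof -
  have h: "h > 0" using assms by simp
  show "0 \<le> level k h j l" using level_mono[OF h, of 0 l k j] assms by simp
  show "level k h j l \<le> int k - int k div h"
    using level_mono[OF h, of l "h - 1" k j] level_top[OF h assms(3)] assms by simp
qed

lemma coeff_level_poly:
  "coeff (level_poly k h j) i = real (card {l \<in> {0..<h}. nat (level k h j l) = i})"
  by (simp add: level_poly_def coeff_sum sum.If_cases Int_def conj_commute)

lemma coeff_level_poly_pos:
  assumes "l \<in> {0..<h}"
  shows "coeff (level_poly k h j) (nat (level k h j l)) > 0"
  unfolding coeff_level_poly of_nat_0_less_iff card_gt_0_iff
  using assms by (auto intro: finite_subset[of _ "{0..<h}"])

lemma coeff_level_poly_0: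
  assumes "h > 0"
  shows "coeff (level_poly k h j) 0 > 0"
  using coeff_level_poly_pos[of 0 h k j] assms by simp

text \<open>The coefficients are counts, so nothing cancels at the largest exponent, the level at
  \<open>h - 1\<close>.\<close>

lemma degree_level_poly:
  assumes "h > 0" "coprime j h"
  shows "degree (level_poly k h j) = nat (int k - int k div h)"
proof (rule antisym)
  show "degree (level_poly k h j) \<le> nat (int k - int k div h)"
    unfolding level_poly_def using assms level_bounds(2)[OF _ _ assms(2), of _ k]
    by (intro degree_sum_le order.trans[OF degree_monom_le]) (auto intro!: nat_mono)
  show "nat (int k - int k div h) \<le> degree (level_poly k h j)"
    using coeff_level_poly_pos[of "h - 1" h k j] assms
    by (intro le_degree) (simp add: level_top)
qed

lemma bij_betw_diff_mod_int:
  assumes "h > 0"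
  shows "bij_betw (\<lambda>l. (l - c) mod h) {0..<h} {0..<h :: int}"
proof (rule bij_betw_byWitness[where f' = "\<lambda>l. (l + c) mod h"])
  show "\<forall>l\<in>{0..<h}. ((l - c) mod h + c) mod h = l"
    by (simp add: mod_add_left_eq)
  show "\<forall>l\<in>{0..<h}. ((l + c) mod h - c) mod h = l"
    by (simp add: mod_diff_left_eq)
qed (use assms in auto)

text \<open>Rotating the index by \<open>c\<close> only permutes the monomials; afterwards the two
  sums agree term by term modulo \<open>x^m - 1\<close>.\<close>

lemma monom_minus_one_dvd_level_poly:
  assumes h: "h > 0" and j: "coprime j h"
    and cong: "\<And>l. l \<in> {0..<h} \<Longrightarrow>
      [level k h (- j) l = level k h j ((l - c) mod h) + int e] (mod int m)"
  shows "monom 1 m - 1 dvd monom 1 e * level_poly k h j - level_poly k h (- j)"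
proof -
  have "level_poly k h j = (\<Sum>l\<in>{0..<h}. monom 1 (nat (level k h j ((l - c) mod h))))"
    unfolding level_poly_def by (rule sum.reindex_bij_betw[OF bij_betw_diff_mod_int[OF h], symmetric])
  hence "monom 1 e * level_poly k h j - level_poly k h (- j)
      = (\<Sum>l\<in>{0..<h}. monom 1 (e + nat (level k h j ((l - c) mod h))) - monom 1 (nat (level k h (- j) l)))"
    by (simp add: level_poly_def[of k h "- j"] sum_distrib_left sum_subtractf mult_monom)
  also have "monom 1 m - 1 dvd \<dots>"
  proof (intro dvd_sum monom_minus_one_dvd)
    fix l assume l: "l \<in> {0..<h}"
    have "0 \<le> level k h j ((l - c) mod h)" using h j by (intro level_bounds) auto
    moreover have "0 \<le> level k h (- j) l" using l j by (intro level_bounds) auto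
    ultimately have "[int (e + nat (level k h j ((l - c) mod h))) = int (nat (level k h (- j) l))] (mod int m)"
      using cong_sym[OF cong[OF l]] by (simp add: add.commute)
    thus "[e + nat (level k h j ((l - c) mod h)) = nat (level k h (- j) l)] (mod m)"
      unfolding cong_int_iff .
  qed
  finally show ?thesis .
qed

lemma level_cong_exponent:
  assumes h: "h > 0" and e: "[int e = peak k h j] (mod int (k^2 + k))"
  shows "[level k h (- j) l = level k h j ((l - (int k + 1) * j) mod h) + int e] (mod int k)"
    and "l \<in> {0..<h} \<Longrightarrow>
      [level k h (- j) l = level k h j ((l - int k * j) mod h) + int e] (mod int (k + 1))"
proof -
  have L: "int (k\<^sup>2 + k) = int k * (int k + 1)" by (simp add: power2_eq_square algebra_simps)
  have 1: "[peak k h j = int e] (mod int k)" "[peak k h j = int e] (mod (int k + 1))"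
    by (rule cong_dvd_modulus[OF cong_sym[OF e]], simp only: L dvd_triv_left dvd_triv_right)+
  show "[level k h (- j) l = level k h j ((l - (int k + 1) * j) mod h) + int e] (mod int k)"
    by (rule cong_trans[OF level_cong[OF h] cong_add[OF cong_refl 1(1)]])
  show "[level k h (- j) l = level k h j ((l - int k * j) mod h) + int e] (mod int (k + 1))"
    if "l \<in> {0..<h}"
    using cong_trans[OF level_cong'[of l h k j] cong_add[OF cong_refl 1(2)]] that
    by (simp add: add.commute)
qed

text \<open>The exponents are matched modulo \<open>k\<close> by the rotation by
  \<open>(k + 1) * j\<close>, and modulo \<open>k + 1\<close> by the rotation by
  \<open>k * j\<close>.\<close>

lemma band_poly_dvd_level_poly:
  assumes k: "k \<ge> 1" and h: "h > 0" and j: "coprime j h"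
    and e: "[int e = peak k h j] (mod int (k^2 + k))"
  shows "band_poly k dvd monom 1 e * level_poly k h j - level_poly k h (- j)"
  using level_cong_exponent[OF h e]
  by (intro band_poly_dvdI[OF k] monom_minus_one_dvd_level_poly[OF h j]) auto

section \<open>Minimality of the explicit solutions\<close>

lemma periodic_const:
  fixes w :: "int \<Rightarrow> real"
  assumes h: "h > 0" and j: "coprime j h" and per: "\<And>m. w (m mod h) = w m"
    and step: "\<And>m. w m = w (m - j) + c"
  shows "c = 0" "w m = w m'"
proof -
  have iter: "w m = w (m - int i * j) + real i * c" for m i
  proof (induction i)
    case (Suc i)
    thus ?case using step[of "m - int i * j"] by (simp add: algebra_simps)
  qed simp
  \<comment> \<open>After \<open>h\<close> steps the argument is back in its residue class, so
    \<open>h * c = 0\<close>.\<close>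
  have "w 0 = w (0 - int (nat h) * j)"
    using per[of "0 - int (nat h) * j"] h by simp
  with iter[of 0 "nat h"] have "real (nat h) * c = 0" by linarith
  thus c: "c = 0" using h by simp
  \<comment> \<open>Since \<open>j\<close> is invertible modulo \<open>h\<close>, some number of
    steps leads from \<open>m\<close> to the class of \<open>m'\<close>.\<close>
  from cong_solve_coprime_int[OF j] obtain x where "[j * x = 1] (mod h)" ..
  define i where "i = x * (m - m')"
  have "[j * i = m - m'] (mod h)"
    using cong_scalar_right[OF \<open>[j * x = 1] (mod h)\<close>, of "m - m'"] by (simp add: i_def mult.assoc)
  from cong_diff[OF cong_refl[of m] this] have "[m - i * j = m'] (mod h)"
    by (simp add: mult.commute)
  moreover have "[m - (i mod h) * j = m - i * j] (mod h)"
    by (intro cong_diff cong_refl cong_mult) (simp add: cong_def)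
  ultimately have "[m - (i mod h) * j = m'] (mod h)" using cong_trans by blast
  hence "w (m - (i mod h) * j) = w m'" using per by (metis cong_def)
  with iter[of m "nat (i mod h)"] h c show "w m = w m'" by simp
qed

text \<open>On the levels, \<open>geom_poly k\<close> identifies \<open>q\<close> with
  \<open>p\<close> rotated by \<open>(k + 1) * j\<close> up to a constant, and
  \<open>x^(k+1) - 1\<close> identifies it with \<open>p\<close> rotated by \<open>k * j\<close>.
  Comparing the two gives a recurrence with step \<open>j\<close>, so the coefficients of
  \<open>p\<close> on the levels are all equal.\<close>

lemma solution_constant_coeff_0:
  assumes k: "k \<ge> 1" and h: "0 < h" "h \<le> int k" and j: "coprime j h"
    and e: "[int e = peak k h j] (mod int (k^2 + k))"
    and dvd: "band_poly k dvd monom 1 e * p - q"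
    and p: "\<forall>i\<ge>nat (int k - int k div h). coeff p i = 0"
    and q: "\<forall>i\<ge>nat (int k - int k div h). coeff q i = 0"
  shows "coeff p 0 = 0 \<and> coeff q 0 = 0"
proof -
  let ?d = "nat (int k - int k div h)"
  have G: "int k div h \<ge> 1" using h by (simp add: pos_imp_zdiv_pos_iff int_one_le_iff_zero_less)
  hence d: "?d < k" using k by linarith
  have lt: "nat (level k h j l) < k" "nat (level k h (- j) l) < k" if "0 \<le> l" "l < h" for l
    using level_bounds[of l h j k] level_bounds[of l h "- j" k] that j G k by auto
  have "monom 1 (k + 1) - 1 dvd monom 1 e * p - q" "geom_poly k dvd monom 1 e * p - q"
    using dvd k by (simp_all add: band_poly_dvd_iff)
  note dvds = this
  have pk: "\<forall>i\<ge>k. coeff p i = 0" "\<forall>i\<ge>k. coeff q i = 0" using p q d by auto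
  from coeff_eq_if_geom_poly_dvd[OF dvds(2) pk] obtain c where
    c: "\<And>i i'. i < k \<Longrightarrow> i' < k \<Longrightarrow> [i' = i + e] (mod k) \<Longrightarrow> coeff q i' = coeff p i + c" by blast
  have pk1: "\<forall>i\<ge>k+1. coeff p i = 0" "\<forall>i\<ge>k+1. coeff q i = 0" using p q d by auto
  note c1 = coeff_eq_if_monom_minus_one_dvd[OF dvds(1) pk1]
  define w where "w m = coeff p (nat (level k h j (m mod h)))" for m
  have tow: "coeff q (nat (level k h (- j) l)) = w (l - (int k + 1) * j) + c"
            "coeff q (nat (level k h (- j) l)) = w (l - int k * j)" if l: "l \<in> {0..<h}" for l
  proof -
    have pos: "0 \<le> level k h j (m mod h)" for m using h j by (intro level_bounds) auto
    have pos': "0 \<le> level k h (- j) l" using l j by (intro level_bounds) auto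
    have "[int (nat (level k h (- j) l)) = int (nat (level k h j ((l - (int k + 1) * j) mod h)) + e)] (mod int k)"
      using level_cong_exponent(1)[OF h(1) e, of l] pos pos' by simp
    hence "[nat (level k h (- j) l) = nat (level k h j ((l - (int k + 1) * j) mod h)) + e] (mod k)"
      unfolding cong_int_iff .
    thus "coeff q (nat (level k h (- j) l)) = w (l - (int k + 1) * j) + c"
      unfolding w_def using l h by (intro c lt) auto
    have "[int (nat (level k h (- j) l)) = int (nat (level k h j ((l - int k * j) mod h)) + e)] (mod int (k + 1))"
      using level_cong_exponent(2)[OF h(1) e l] pos pos' by simp
    hence "[nat (level k h (- j) l) = nat (level k h j ((l - int k * j) mod h)) + e] (mod (k + 1))"
      unfolding cong_int_iff .
    thus "coeff q (nat (level k h (- j) l)) = w (l - int k * j)"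
      unfolding w_def using l h by (intro c1) (auto intro!: less_SucI lt)
  qed
  have per: "w (m mod h) = w m" for m by (simp add: w_def)
  have step: "w m = w (m - j) + c" for m
  proof -
    define l where "l = (m + int k * j) mod h"
    have l: "l \<in> {0..<h}" using h by (simp add: l_def)
    have "w (l - int k * j) = w m"
      using per[of "l - int k * j"] per[of m] by (simp add: l_def mod_diff_left_eq)
    moreover have "w (l - (int k + 1) * j) = w (m - j)"
      using per[of "l - (int k + 1) * j"] per[of "m - j"]
      by (simp add: l_def mod_diff_left_eq algebra_simps)
    ultimately show ?thesis using tow[OF l] by simp
  qed
  note const = periodic_const[OF h(1) j per step]
  \<comment> \<open>The level at \<open>h - 1\<close> is exactly the degree bound, where
    \<open>p\<close> already vanishes; the level at 0 is the constant coefficient.\<close>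
  have "(h - 1) mod h = h - 1" by (rule mod_pos_pos_trivial) (use h in auto)
  hence "w (h - 1) = 0" using p h j by (simp only: w_def level_top)
  hence w0: "w m = 0" for m using const(2)[of m "h - 1"] by simp
  have "coeff p 0 = 0" using w0[of 0] by (simp add: w_def)
  moreover have "coeff q 0 = 0" using tow(2)[of 0] w0 h by simp
  ultimately show ?thesis by simp
qed

lemma coprime_monom_band_poly:
  assumes "k \<ge> 1" shows "coprime (monom 1 n) (band_poly k)"
  using assms by (intro coprime_monom_one) (simp add: coeff_band_poly)

lemma band_poly_dvd_monom_mult_iff:
  assumes "k \<ge> 1" shows "band_poly k dvd monom 1 n * f \<longleftrightarrow> band_poly k dvd f"
  using coprime_monom_band_poly[OF assms] by (metis coprime_commute coprime_dvd_mult_right_iff)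

lemma monom_one_dvdE:
  fixes p :: "'a :: comm_ring_1 poly"
  assumes "coeff p 0 = 0"
  obtains p' where "p = monom 1 1 * p'" "\<And>i. coeff p' i = coeff p (Suc i)"
proof (rule that)
  show "p = monom 1 1 * poly_shift 1 p"
    by (rule poly_eqI) (use assms in \<open>auto simp: coeff_monom_mult coeff_poly_shift not_le\<close>)
qed (simp add: coeff_poly_shift)

text \<open>Once the constant coefficients vanish, both polynomials can be divided by
  \<open>x\<close>, which is coprime to the band polynomial, and the argument repeats.\<close>

lemma solution_below_peak_eq_0:
  assumes k: "k \<ge> 1" and h: "0 < h" "h \<le> int k" and j: "coprime j h"
    and e: "[int e = peak k h j] (mod int (k^2 + k))"
    and "band_poly k dvd monom 1 e * p - q"
    and "\<forall>i\<ge>nat (int k - int k div h). coeff p i = 0"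
    and "\<forall>i\<ge>nat (int k - int k div h). coeff q i = 0"
  shows "p = 0 \<and> q = 0"
proof -
  have "coeff p n = 0 \<and> coeff q n = 0" for n
    using assms(6-8)
  proof (induction n arbitrary: p q)
    case 0
    thus ?case using solution_constant_coeff_0[OF k h j e] by blast
  next
    case (Suc n)
    have "coeff p 0 = 0 \<and> coeff q 0 = 0" using solution_constant_coeff_0[OF k h j e Suc.prems] .
    then obtain p' q' where p': "p = monom 1 1 * p'" "\<And>i. coeff p' i = coeff p (Suc i)"
      and q': "q = monom 1 1 * q'" "\<And>i. coeff q' i = coeff q (Suc i)"
      by (metis monom_one_dvdE)
    have "monom 1 e * p - q = monom 1 1 * (monom 1 e * p' - q')"
      unfolding p' q' by (simp add: algebra_simps)
    hence "band_poly k dvd monom 1 e * p' - q'"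
      using Suc.prems(1) band_poly_dvd_monom_mult_iff[OF k] by metis
    from Suc.IH[OF this] show ?case using Suc.prems(2,3) by (simp add: p'(2) q'(2))
  qed
  thus ?thesis by (simp add: poly_eq_iff)
qed

section \<open>The kernel of the Toeplitz matrix\<close>

lemma band_poly_dvd_shift_iff:
  assumes k: "k \<ge> 1" and "[e = e'] (mod (k^2 + k))"
  shows "band_poly k dvd monom 1 e * p - q \<longleftrightarrow> band_poly k dvd monom 1 e' * p - q"
proof -
  have "band_poly k dvd (monom 1 e - monom 1 e') * p"
    using band_poly_dvd_monom_diff[OF assms] by (rule dvd_mult2)
  moreover have "monom 1 e * p - q = (monom 1 e - monom 1 e') * p + (monom 1 e' * p - q)"
    by (simp add: algebra_simps)
  ultimately show ?thesis by (metis dvd_add_right_iff)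
qed

text \<open>Two solutions of low degree are proportional, since their cross difference is a multiple of
  the band polynomial of degree less than twice the bandwidth.\<close>

lemma solution_multiple:
  assumes k: "k \<ge> 1" and G: "G \<le> k"
    and deg: "degree p0 = k - G" "degree q0 = k - G"
    and c0: "coeff p0 0 \<noteq> 0"
    and dvd0: "band_poly k dvd monom 1 E * p0 - q0"
    and min: "\<And>p q. band_poly k dvd monom 1 E * p - q \<Longrightarrow> \<forall>i\<ge>k - G. coeff p i = 0 \<Longrightarrow>
      \<forall>i\<ge>k - G. coeff q i = 0 \<Longrightarrow> p = 0 \<and> q = 0"
    and q0: "q0 \<noteq> 0"
    and s: "s \<le> G" and e: "[e = E + s] (mod (k^2 + k))"
    and dvd: "band_poly k dvd monom 1 e * p - q"
    and pk: "\<forall>i\<ge>k. coeff p i = 0" and qk: "\<forall>i\<ge>k. coeff q i = 0"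
  shows "\<exists>u. p = u * p0 \<and> q = monom 1 s * u * q0 \<and> (\<forall>i\<ge>G - s. coeff u i = 0)"
proof -
  have p0: "p0 \<noteq> 0" using c0 by auto
  have degp: "degree p \<le> k - 1" and degq: "degree q \<le> k - 1"
    using pk qk k by (intro degree_le; force)+
  have dvd_Es: "band_poly k dvd monom 1 (E + s) * p - q"
    using dvd band_poly_dvd_shift_iff[OF k e] by simp
  have "band_poly k dvd monom 1 s * p * (monom 1 E * p0 - q0) - p0 * (monom 1 (E + s) * p - q)"
    by (rule dvd_diff; rule dvd_mult) (rule dvd0 dvd_Es)+
  also have "\<dots> = q * p0 - monom 1 s * p * q0"
    by (simp add: algebra_simps mult_monom flip: mult.assoc)
  finally have cross_dvd: "band_poly k dvd q * p0 - monom 1 s * p * q0" .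
  have "degree (q * p0 - monom 1 s * p * q0) \<le> 2 * k - 1"
  proof (rule degree_diff_le)
    show "degree (q * p0) \<le> 2 * k - 1"
      using degree_mult_le[of q p0] degq deg G k by simp
    have "degree (monom 1 s * p * q0) \<le> degree (monom 1 s * p) + degree q0"
      by (rule degree_mult_le)
    also have "\<dots> \<le> s + degree p + degree q0"
      using degree_mult_le[of "monom 1 s" p] by (simp add: degree_monom_eq)
    finally show "degree (monom 1 s * p * q0) \<le> 2 * k - 1"
      using degp deg G k s by simp
  qed
  hence "degree (q * p0 - monom 1 s * p * q0) < degree (band_poly k)"
    using k by (simp add: degree_band_poly)
  with cross_dvd have "q * p0 - monom 1 s * p * q0 = 0"
    by (metis dvd_imp_degree_le not_le)
  hence cross: "q * p0 = monom 1 s * p * q0" by simp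
  \<comment> \<open>Since \<open>p0\<close> has a nonzero constant coefficient, the power of
    \<open>x\<close> must divide \<open>q\<close>; this reduces the offset \<open>s\<close> to
    0.\<close>
  have "monom 1 s dvd q * p0" unfolding cross mult.assoc by simp
  hence "monom 1 s dvd q" using coprime_dvd_mult_left_iff[OF coprime_monom_one[OF c0]] by simp
  then obtain q' where q': "q = monom 1 s * q'" by (auto elim: dvdE)
  have cross': "q' * p0 = p * q0" using cross unfolding q' mult.assoc by simp
  have "monom 1 (E + s) * p - q = monom 1 s * (monom 1 E * p - q')"
    by (simp add: q' algebra_simps mult_monom flip: mult.assoc)
  hence dvd': "band_poly k dvd monom 1 E * p - q'"
    using dvd_Es band_poly_dvd_monom_mult_iff[OF k] by metis
  \<comment> \<open>Subtracting the same multiple \<open>u\<close> of the basic pair leaves a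
    solution \<open>(r, r')\<close> at \<open>E\<close>. The cross relation carries the degree bound
    from \<open>r\<close> to \<open>r'\<close>, and minimality then forces both to vanish.\<close>
  define u where "u = p div p0"
  define r where "r = p mod p0"
  define r' where "r' = q' - u * q0"
  have p_eq: "p = u * p0 + r" by (simp add: u_def r_def)
  have rr: "r' * p0 = r * q0"
    using cross' by (simp add: r'_def p_eq algebra_simps)
  have "r = 0"
  proof (rule ccontr)
    assume r: "r \<noteq> 0"
    have "r' \<noteq> 0" using rr r q0 by auto
    have "degree (r' * p0) = degree (r * q0)" by (simp add: rr)
    hence deg': "degree r' = degree r" using \<open>r' \<noteq> 0\<close> r q0 p0 deg by (simp add: degree_mult_eq)
    have lt: "degree r < k - G"
      using degree_mod_less[OF p0, of p] r deg by (simp add: r_def)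
    have "monom 1 E * r - r' = (monom 1 E * p - q') - u * (monom 1 E * p0 - q0)"
      by (simp add: r'_def p_eq algebra_simps)
    hence "band_poly k dvd monom 1 E * r - r'"
      using dvd_diff[OF dvd' dvd_mult[OF dvd0]] by simp
    moreover have "\<forall>i\<ge>k - G. coeff r i = 0" "\<forall>i\<ge>k - G. coeff r' i = 0"
      using lt deg' by (auto intro!: coeff_eq_0)
    ultimately show False using min r by blast
  qed
  hence "r' = 0" using rr p0 by simp
  have "p = u * p0" "q = monom 1 s * u * q0"
    using \<open>r = 0\<close> \<open>r' = 0\<close> p_eq q' by (auto simp: r'_def mult.assoc)
  moreover have "coeff u i = 0" if i: "i \<ge> G - s" for i
  proof (cases "u = 0")
    case False
    have "degree q = s + degree u + (k - G)"
      using False q0 deg \<open>q = monom 1 s * u * q0\<close> by (simp add: degree_mult_eq degree_monom_eq)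
    hence "degree u < G - s" using degq G s k by linarith
    thus ?thesis using i by (intro coeff_eq_0) simp
  qed simp
  ultimately show ?thesis by blast
qed

text \<open>The new exponent represents \<open>- e\<close> modulo \<open>k^2 + k\<close>:
  multiplying by the inverse power of \<open>x\<close> exchanges the roles of \<open>p\<close> and
  \<open>q\<close>.\<close>

lemma band_poly_dvd_swap:
  assumes k: "k \<ge> 1" and "band_poly k dvd monom 1 e * p - q"
  shows "band_poly k dvd monom 1 ((k^2 + k - 1) * e) * q - p"
proof -
  let ?f = "(k^2 + k - 1) * e"
  have "band_poly k dvd monom 1 (?f + e) - monom 1 0"
  proof (rule band_poly_dvd_monom_diff[OF k])
    have "?f + e = (k^2 + k - 1 + 1) * e" by (simp only: add_mult_distrib mult_1)
    hence "?f + e = (k^2 + k) * e" using k by simp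
    thus "[?f + e = 0] (mod (k^2 + k))" by (simp add: cong_0_iff)
  qed
  hence "band_poly k dvd (monom 1 (?f + e) - 1) * p - monom 1 ?f * (monom 1 e * p - q)"
    using assms(2) by (intro dvd_diff[OF dvd_mult2 dvd_mult]) simp_all
  also have "\<dots> = monom 1 ?f * q - p"
    by (simp add: algebra_simps mult_monom flip: mult.assoc)
  finally show ?thesis .
qed

section \<open>Kernel vectors as polynomial solutions\<close>

lemma coeff_toepA_mult:
  assumes v: "v \<in> carrier_vec n" and i: "i < n"
  shows "vec_index (toepA n k *\<^sub>v v) i
    = coeff (band_poly k * (\<Sum>j<n. monom (vec_index v j) j)) (k + i)"
proof -
  have "coeff (band_poly k * (\<Sum>j<n. monom (vec_index v j) j)) (k + i)
      = (\<Sum>j<n. coeff (monom (vec_index v j) j * band_poly k) (k + i))"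
    by (simp add: sum_distrib_left coeff_sum mult.commute)
  \<comment> \<open>The entry in row \<open>i\<close> and column \<open>j\<close> is the band
    coefficient in degree \<open>k + i - j\<close>; the zero coefficient in degree \<open>k\<close>
    lies on the diagonal.\<close>
  also have "\<dots> = (\<Sum>j<n. (if i < j \<and> j - i \<le> k then 1 else if j < i \<and> i - j \<le> k then -1 else 0)
      * vec_index v j)"
    by (intro sum.cong refl) (auto simp: coeff_monom_mult coeff_band_poly)
  also have "\<dots> = vec_index (toepA n k *\<^sub>v v) i"
    using v i by (auto simp: toepA_def scalar_prod_def lessThan_atLeast0 intro!: sum.cong)
  finally show ?thesis by simp
qed

text \<open>Let \<open>W\<close> be the quotient of \<open>x^(n+k) * P0 - Q0\<close> by the band
  polynomial. The kernel consists of the products \<open>u * W\<close> with \<open>u\<close> of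
  degree less than \<open>z\<close>, so the vectors of \<open>x^i * W\<close> with
  \<open>i < z\<close> form a basis.\<close>

lemma kernel_dim_toepA:
  assumes k: "k \<ge> 1" and z: "z \<le> k"
    and dvd: "band_poly k dvd monom 1 (n + k) * P0 - Q0" and P0: "P0 \<noteq> 0"
    and degs: "degree P0 \<le> k - z" "degree Q0 \<le> k - z"
    and gen: "\<And>P Q. band_poly k dvd monom 1 (n + k) * P - Q \<Longrightarrow> \<forall>i\<ge>k. coeff P i = 0 \<Longrightarrow>
      \<forall>i\<ge>k. coeff Q i = 0 \<Longrightarrow> \<exists>u. P = u * P0 \<and> Q = u * Q0 \<and> (\<forall>i\<ge>z. coeff u i = 0)"
  shows "kernel_dim (toepA n k) = z"
proof -
  let ?B = "band_poly k" and ?F = "monom 1 (n + k) * P0 - Q0"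
  obtain W where W: "?F = ?B * W" using dvd by (auto elim: dvdE)
  \<comment> \<open>For \<open>z > 0\<close> the degree of \<open>Q0\<close> is below
    \<open>k\<close>, so it cannot cancel the leading term of \<open>x^(n+k) * P0\<close>.\<close>
  have W0: "z > 0 \<Longrightarrow> W \<noteq> 0"
  proof
    assume "z > 0" "W = 0"
    hence "coeff ?F (n + k + degree P0) = 0" by (simp add: W)
    moreover have "coeff Q0 (n + k + degree P0) = 0"
      using degs \<open>z > 0\<close> k by (intro coeff_eq_0) simp
    ultimately show False using P0 by (simp add: coeff_monom_mult)
  qed
  have cuW: "coeff (u * W) j = 0" if u: "\<forall>i\<ge>z. coeff u i = 0" and j: "j \<ge> n" for u j
  proof (cases "u * W = 0")
    case False
    hence uW: "u \<noteq> 0" "W \<noteq> 0" by auto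
    have degu: "degree u < z" using u uW(1) by (metis leading_coeff_0_iff not_le)
    have "2 * k + degree (u * W) = degree (u * ?F)"
      unfolding W using uW k by (simp add: degree_mult_eq degree_band_poly band_poly_nonzero)
    also have "\<dots> \<le> degree u + degree ?F" by (rule degree_mult_le)
    also have "degree ?F \<le> n + k + (k - z)"
    proof (rule degree_diff_le)
      have "degree (monom 1 (n + k) * P0) \<le> (n + k) + degree P0"
        using degree_mult_le[of "monom 1 (n + k)" P0] by (simp add: degree_monom_eq)
      thus "degree (monom 1 (n + k) * P0) \<le> n + k + (k - z)" using degs by simp
    qed (use degs in simp)
    finally have "degree (u * W) < n" using degu z by simp
    thus ?thesis using j by (intro coeff_eq_0) simp
  qed auto
  \<comment> \<open>The product has a gap in the degrees \<open>k\<close> to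
    \<open>n + k - 1\<close>: \<open>u * Q0\<close> ends before it and the other term starts after
    it.\<close>
  have cuF: "coeff (u * ?F) (k + j) = 0" if u: "\<forall>i\<ge>z. coeff u i = 0" and j: "j < n" for u j
  proof (cases "u = 0")
    case False
    have "degree u < z" using u False by (metis leading_coeff_0_iff not_le)
    hence "degree (u * Q0) < k"
      using degree_mult_le[of u Q0] degs z by simp
    hence "coeff (u * Q0) (k + j) = 0" by (intro coeff_eq_0) simp
    moreover have "u * ?F = monom 1 (n + k) * (u * P0) - u * Q0" by (simp add: algebra_simps)
    ultimately show ?thesis using j by (simp add: coeff_monom_mult)
  qed simp
  have vecW: "(\<Sum>j<n. monom (vec_index (Matrix.vec n (coeff (u * W))) j) j) = u * W"
    if "\<forall>i\<ge>z. coeff u i = 0" for u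
    using poly_as_sum_less[of n "u * W"] cuW[OF that] by simp
  define b where "b i = Matrix.vec n (coeff (monom 1 i * W))" for i
  show ?thesis
  proof (rule kernel_dim_eqI[where b = b])
    show A: "toepA n k \<in> carrier_mat n n" by (simp add: toepA_def)
    show "b i \<in> mat_kernel (toepA n k)" if i: "i < z" for i
    proof (rule mat_kernelI[OF A])
      show bc: "b i \<in> carrier_vec n" by (simp add: b_def)
      have ci: "\<forall>l\<ge>z. coeff (monom 1 i :: real poly) l = 0" using i by simp
      show "toepA n k *\<^sub>v b i = 0\<^sub>v n"
      proof (rule eq_vecI)
        fix l assume "l < dim_vec (0\<^sub>v n)"
        hence l: "l < n" by simp
        have "vec_index (toepA n k *\<^sub>v b i) l = coeff (?B * (monom 1 i * W)) (k + l)"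
          unfolding coeff_toepA_mult[OF bc l] unfolding b_def vecW[OF ci] ..
        also have "?B * (monom 1 i * W) = monom 1 i * ?F" unfolding W by (simp add: algebra_simps)
        finally show "vec_index (toepA n k *\<^sub>v b i) l = vec_index (0\<^sub>v n) l"
          using cuF[OF ci l] l by simp
      qed (simp add: toepA_def)
    qed
    show "c i = 0" if c: "\<And>j. j < n \<Longrightarrow> (\<Sum>i<z. c i * vec_index (b i) j) = 0" and i: "i < z" for c i
    proof -
      define u where "u = (\<Sum>i<z. monom (c i) i)"
      have cu: "coeff u l = (if l < z then c l else 0)" for l
        by (simp add: u_def coeff_sum)
      have "coeff (u * W) j = 0" for j
      proof (cases "j < n")
        case True
        have "coeff (u * W) j = (\<Sum>i<z. c i * coeff (monom 1 i * W) j)"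
          by (simp add: u_def sum_distrib_right coeff_sum coeff_monom_mult if_distrib cong: if_cong)
        thus ?thesis using c[OF True] True by (simp add: b_def)
      qed (use cuW[of u j] cu in auto)
      hence "u * W = 0" by (simp add: poly_eq_iff)
      hence "u = 0" using W0 i by auto
      thus "c i = 0" using cu[of i] i by simp
    qed
    show "\<exists>c. \<forall>j<n. vec_index v j = (\<Sum>i<z. c i * vec_index (b i) j)"
      if v: "v \<in> mat_kernel (toepA n k)" for v
    proof -
      note v' = mat_kernelD[OF A v]
      define V where "V = (\<Sum>j<n. monom (vec_index v j) j)"
      have cV: "coeff V j = (if j < n then vec_index v j else 0)" for j
        by (simp add: V_def coeff_sum)
      define f where "f = ?B * V"
      have f0: "coeff f (k + i) = 0" if "i < n" for i
        using coeff_toepA_mult[OF v'(1) that, of k] v'(2) that by (simp add: f_def V_def)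
      have f1: "coeff f i = 0" if i: "i \<ge> n + 2 * k" for i
      proof (cases "V = 0")
        case False
        hence "degree V < n" using cV by (metis leading_coeff_0_iff)
        hence "degree f < n + 2 * k"
          using False k by (simp add: f_def degree_mult_eq degree_band_poly band_poly_nonzero)
        thus ?thesis using i by (intro coeff_eq_0) simp
      qed (simp add: f_def)
      \<comment> \<open>\<open>P\<close> is the part of \<open>f\<close> above the gap, and
        \<open>Q\<close> is minus the part below it.\<close>
      define P where "P = poly_shift (n + k) f"
      define Q where "Q = - poly_cutoff k f"
      have f_eq: "f = monom 1 (n + k) * P - Q"
      proof (rule poly_eqI)
        fix i
        consider "i < k" | "k \<le> i" "i < n + k" | "n + k \<le> i" by linarith
        thus "coeff f i = coeff (monom 1 (n + k) * P - Q) i"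
        proof cases
          case 2
          thus ?thesis using f0[of "i - k"]
            by (simp add: P_def Q_def coeff_monom_mult coeff_poly_cutoff)
        qed (auto simp: P_def Q_def coeff_monom_mult coeff_poly_shift coeff_poly_cutoff)
      qed
      have "?B dvd monom 1 (n + k) * P - Q" unfolding f_eq[symmetric] f_def by simp
      moreover have "\<forall>i\<ge>k. coeff P i = 0" using f1 by (simp add: P_def coeff_poly_shift)
      moreover have "\<forall>i\<ge>k. coeff Q i = 0" by (simp add: Q_def coeff_poly_cutoff)
      ultimately obtain u where u: "P = u * P0" "Q = u * Q0" "\<forall>i\<ge>z. coeff u i = 0"
        using gen by blast
      have "?B * V = ?B * (u * W)"
      proof -
        have "?B * V = u * ?F" using f_eq unfolding f_def u by (simp add: algebra_simps)
        thus ?thesis unfolding W by (simp add: algebra_simps)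
      qed
      hence V: "V = u * W" using band_poly_nonzero[OF k] by simp
      have "vec_index v j = (\<Sum>i<z. coeff u i * vec_index (b i) j)" if j: "j < n" for j
      proof -
        have "vec_index v j = coeff (u * W) j" using cV[of j] j by (simp add: V)
        also have "\<dots> = coeff ((\<Sum>i<z. monom (coeff u i) i) * W) j"
          using poly_as_sum_less[OF u(3)] by simp
        also have "\<dots> = (\<Sum>i<z. coeff u i * coeff (monom 1 i * W) j)"
          by (simp add: sum_distrib_right coeff_sum coeff_monom_mult if_distrib cong: if_cong)
        finally show ?thesis using j by (simp add: b_def)
      qed
      thus ?thesis by blast
    qed
  qed
qed

lemma peak_minus: "peak k h (- j) = - peak k h j"
  by (simp add: peak_def sum_negf[symmetric])

lemma nat_diff_div: "nat (int k - int k div int h) = k - k div h"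
  by (simp add: zdiv_int[symmetric] nat_diff_distrib')

lemma period_pos: "k \<ge> 1 \<Longrightarrow> 0 < int (k^2 + k)"
  unfolding of_nat_0_less_iff by simp

lemma peak_exponent:
  assumes "k \<ge> 1"
  obtains E where "[int E = peak k h j] (mod int (k^2 + k))"
proof (rule that)
  have "peak k h j mod int (k^2 + k) \<ge> 0" by (rule pos_mod_sign[OF period_pos[OF assms]])
  thus "[int (nat (peak k h j mod int (k^2 + k))) = peak k h j] (mod int (k^2 + k))"
    by (simp only: cong_def int_nat_eq if_True mod_mod_trivial)
qed

lemma level_poly_nonzero: "h > 0 \<Longrightarrow> level_poly k h j \<noteq> 0"
  using coeff_level_poly_0[of h k j] by auto

lemma solution_multiple_level_poly:
  fixes h :: nat
  assumes k: "k \<ge> 1" and h: "0 < h" "h \<le> k" and j: "coprime j (int h)"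
    and s: "s \<le> k div h" and e: "[int e = peak k h j + int s] (mod int (k^2 + k))"
    and "band_poly k dvd monom 1 e * p - q"
    and "\<forall>i\<ge>k. coeff p i = 0" and "\<forall>i\<ge>k. coeff q i = 0"
  shows "\<exists>u. p = u * level_poly k h j \<and> q = monom 1 s * u * level_poly k h (- j)
    \<and> (\<forall>i\<ge>k div h - s. coeff u i = 0)"
proof -
  from peak_exponent[OF k] obtain E where E: "[int E = peak k h j] (mod int (k^2 + k))" .
  have h': "0 < int h" "int h \<le> int k" using h by auto
  have "[int e = int (E + s)] (mod int (k^2 + k))"
    using cong_trans[OF e cong_sym[OF cong_add[OF E cong_refl[of "int s"]]]] by simp
  hence es: "[e = E + s] (mod (k^2 + k))" unfolding cong_int_iff .
  show ?thesis
  proof (rule solution_multiple[OF k _ _ _ _ _ _ _ s es assms(7-9)])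
    show "k div h \<le> k" by simp
    show "degree (level_poly k (int h) j) = k - k div h"
         "degree (level_poly k (int h) (- j)) = k - k div h"
      using h' j by (simp_all add: degree_level_poly nat_diff_div)
    show "coeff (level_poly k (int h) j) 0 \<noteq> 0"
      using coeff_level_poly_0[OF h'(1), of k j] by simp
    show "level_poly k (int h) (- j) \<noteq> 0" using h' by (rule_tac level_poly_nonzero)
    show "band_poly k dvd monom 1 E * level_poly k (int h) j - level_poly k (int h) (- j)"
      by (rule band_poly_dvd_level_poly[OF k h'(1) j E])
    show "p = 0 \<and> q = 0" if "band_poly k dvd monom 1 E * p - q"
      "\<forall>i\<ge>k - k div h. coeff p i = 0" "\<forall>i\<ge>k - k div h. coeff q i = 0" for p q
      using solution_below_peak_eq_0[OF k h' j E, unfolded nat_diff_div] that by blast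
  qed
qed

lemma degree_monom_mult_level_poly_le:
  fixes h :: nat
  assumes "h > 0" "coprime j (int h)" "s \<le> k div h"
  shows "degree (monom 1 s * level_poly k h j) \<le> k - (k div h - s)"
proof -
  have "degree (monom 1 s * level_poly k h j) \<le> s + (k - k div h)"
    using degree_mult_le[of "monom 1 s" "level_poly k h j"] assms
    by (simp add: degree_monom_eq degree_level_poly nat_diff_div)
  also have "\<dots> = k - (k div h - s)" using assms(3) by simp
  finally show ?thesis .
qed

text \<open>The basic pair at the peak is adapted by \<open>x^s\<close>, put on the second component
  for \<open>t \<ge> 0\<close> and on the first for \<open>t < 0\<close>. This raises the degree to
  \<open>k - (k div h - s)\<close> and so leaves room for \<open>k div h - s\<close>
  multipliers.\<close>

lemma kernel_dim_toepA_near_peak: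
  fixes h :: nat and t :: int
  assumes k: "k \<ge> 1" and h: "0 < h" "h \<le> k" and j: "coprime j (int h)"
    and t: "\<bar>t\<bar> \<le> int (k div h)" and n: "[int (n + k) = peak k h j + t] (mod int (k^2 + k))"
  shows "kernel_dim (toepA n k) = k div h - nat \<bar>t\<bar>"
proof -
  define s where "s = nat \<bar>t\<bar>"
  have s: "s \<le> k div h" using t by (simp add: s_def)
  have j': "coprime (- j) (int h)" using j by simp
  from peak_exponent[OF k] obtain E where E: "[int E = peak k h j] (mod int (k^2 + k))" .
  have dvdE: "band_poly k dvd monom 1 E * level_poly k h j - level_poly k h (- j)"
    by (rule band_poly_dvd_level_poly[OF k _ j E]) (use h in simp)
  have le: "k div h - s \<le> k" by (rule order.trans[OF diff_le_self div_le_dividend])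
  show ?thesis unfolding s_def[symmetric]
  proof (cases "t \<ge> 0")
    case True
    hence ts: "t = int s" by (simp add: s_def)
    have "[int (n + k) = int (E + s)] (mod int (k^2 + k))"
      using cong_trans[OF n cong_sym[OF cong_add[OF E cong_refl[of t]]]] ts by simp
    hence es: "[n + k = E + s] (mod (k^2 + k))" unfolding cong_int_iff .
    show "kernel_dim (toepA n k) = k div h - s"
    proof (rule kernel_dim_toepA[OF k le])
      have "monom 1 (E + s) * level_poly k h j - monom 1 s * level_poly k h (- j)
          = monom 1 s * (monom 1 E * level_poly k h j - level_poly k h (- j))"
        by (simp add: algebra_simps mult_monom flip: mult.assoc)
      hence "band_poly k dvd monom 1 (E + s) * level_poly k h j - monom 1 s * level_poly k h (- j)"
        using dvdE by (metis dvd_mult)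
      thus "band_poly k dvd monom 1 (n + k) * level_poly k h j - monom 1 s * level_poly k h (- j)"
        using band_poly_dvd_shift_iff[OF k es] by simp
      show "level_poly k h j \<noteq> 0" using h by (intro level_poly_nonzero) simp
      show "degree (level_poly k h j) \<le> k - (k div h - s)"
        using h j by (simp add: degree_level_poly nat_diff_div diff_le_mono2)
      show "degree (monom 1 s * level_poly k h (- j)) \<le> k - (k div h - s)"
        by (rule degree_monom_mult_level_poly_le[OF h(1) j' s])
      show "\<exists>u. P = u * level_poly k h j \<and> Q = u * (monom 1 s * level_poly k h (- j))
          \<and> (\<forall>i\<ge>k div h - s. coeff u i = 0)"
        if "band_poly k dvd monom 1 (n + k) * P - Q" "\<forall>i\<ge>k. coeff P i = 0" "\<forall>i\<ge>k. coeff Q i = 0"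
        for P Q
        using solution_multiple_level_poly[OF k h j s n[unfolded ts] that]
        by (auto simp: algebra_simps)
    qed
  next
    case False
    hence ts: "t = - int s" by (simp add: s_def)
    have "[int (n + k + s) = int E] (mod int (k^2 + k))"
      using cong_trans[OF cong_add[OF n cong_refl[of "int s"]], of "int E"] cong_sym[OF E] ts by simp
    hence es: "[n + k + s = E] (mod (k^2 + k))" unfolding cong_int_iff .
    show "kernel_dim (toepA n k) = k div h - s"
    proof (rule kernel_dim_toepA[OF k le])
      have "band_poly k dvd monom 1 (n + k + s) * level_poly k h j - level_poly k h (- j)"
        using band_poly_dvd_shift_iff[OF k es] dvdE by simp
      thus "band_poly k dvd monom 1 (n + k) * (monom 1 s * level_poly k h j) - level_poly k h (- j)"
        by (simp add: mult_monom flip: mult.assoc)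
      show "monom 1 s * level_poly k h j \<noteq> 0"
        using level_poly_nonzero[of "int h" k j] h by simp
      show "degree (level_poly k h (- j)) \<le> k - (k div h - s)"
        using h j by (simp add: degree_level_poly nat_diff_div diff_le_mono2)
      show "degree (monom 1 s * level_poly k h j) \<le> k - (k div h - s)"
        by (rule degree_monom_mult_level_poly_le[OF h(1) j s])
      show "\<exists>u. P = u * (monom 1 s * level_poly k h j) \<and> Q = u * level_poly k h (- j)
          \<and> (\<forall>i\<ge>k div h - s. coeff u i = 0)"
        if P: "band_poly k dvd monom 1 (n + k) * P - Q" "\<forall>i\<ge>k. coeff P i = 0" "\<forall>i\<ge>k. coeff Q i = 0"
        for P Q
      proof -
        let ?L = "k^2 + k"
        have L: "int (?L - 1) = int ?L - 1" using k by (simp add: of_nat_diff)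
        \<comment> \<open>Swapping the components negates the exponent and the peak, so the case of
          a nonnegative offset applies to \<open>- j\<close>.\<close>
        have "[int ((?L - 1) * (n + k)) = - int (n + k)] (mod int ?L)"
        proof -
          have "(a - 1) * b - - b = a * b" for a b :: int by (simp add: algebra_simps)
          thus ?thesis unfolding of_nat_mult L cong_iff_dvd_diff by (metis dvd_triv_left)
        qed
        also have "[- int (n + k) = - (peak k h j + t)] (mod int ?L)"
          using n by (simp only: cong_minus_minus_iff)
        finally have "[int ((?L - 1) * (n + k)) = peak k h (- j) + int s] (mod int ?L)"
          by (simp add: peak_minus ts)
        from solution_multiple_level_poly[OF k h j' s this band_poly_dvd_swap[OF k P(1)] P(3,2)]
        show ?thesis by (auto simp: algebra_simps)
      qed
    qed
  qed
qed

section \<open>Counting residues by nullity\<close>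

definition totient_sum :: "nat \<Rightarrow> nat" where
  "totient_sum m = (\<Sum>h=1..m. totient h)"

lemma Collect_mult_le_eq:
  fixes d k :: nat
  assumes "d \<ge> 1"
  shows "{h \<in> {1..k}. h * d \<le> k} = {1..k div d}"
proof (rule Set.set_eqI)
  fix h
  have "h \<le> k div d \<longleftrightarrow> h * d \<le> k" using assms by (simp add: less_eq_div_iff_mult_less_eq)
  moreover have "h \<le> h * d" using assms by simp
  ultimately show "h \<in> {h \<in> {1..k}. h * d \<le> k} \<longleftrightarrow> h \<in> {1..k div d}"
    unfolding mem_Collect_eq atLeastAtMost_iff by linarith
qed

text \<open>From \<open>k\<close> to \<open>k + 1\<close> the quotient by \<open>h\<close> grows by
  one exactly for the divisors \<open>h\<close> of \<open>k + 1\<close>, whose totients sum to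
  \<open>k + 1\<close>.\<close>

lemma sum_totient_div: "2 * (\<Sum>h=1..k. totient h * (k div h)) = k^2 + k"
proof (induction k)
  case (Suc k)
  have "(\<Sum>h=1..Suc k. totient h * (Suc k div h))
      = (\<Sum>h=1..Suc k. totient h * (k div h) + (if h dvd Suc k then totient h else 0))"
    by (intro sum.cong refl) (auto simp: div_Suc dvd_eq_mod_eq_0)
  also have "\<dots> = (\<Sum>h=1..k. totient h * (k div h)) + (\<Sum>h\<in>{h \<in> {1..Suc k}. h dvd Suc k}. totient h)"
  proof -
    have "(\<Sum>h=1..Suc k. totient h * (k div h)) = (\<Sum>h=1..k. totient h * (k div h))" by simp
    thus ?thesis by (simp only: sum.distrib sum.inter_filter[OF finite_atLeastAtMost])
  qed
  also have "{h \<in> {1..Suc k}. h dvd Suc k} = {h. h dvd Suc k}"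
    by (auto dest: dvd_imp_le intro: Suc_leI dvd_pos_nat[of "Suc k"])
  also have "(\<Sum>h\<in>{h. h dvd Suc k}. totient h) = Suc k" by (rule totient_divisor_sum)
  finally show ?case using Suc by (simp add: power2_eq_square)
qed simp

text \<open>Each triple stands for a reduced fraction \<open>j / h\<close> in \<open>(0, 1]\<close>
  and an offset from its peak. Keeping only one endpoint, where the nullity is 0, gives each
  interval exactly \<open>2 * (k div h)\<close> points.\<close>

definition near_peaks :: "nat \<Rightarrow> (nat \<times> nat \<times> int) set" where
  "near_peaks k = (SIGMA h:{1..k}. totatives h \<times> {- int (k div h)<..int (k div h)})"

definition near_peak_pos :: "nat \<Rightarrow> nat \<times> nat \<times> int \<Rightarrow> int" where
  "near_peak_pos k = (\<lambda>(h, j, t). peak k (int h) (int j) + t)"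

lemma card_near_peaks: "card (near_peaks k) = k^2 + k"
proof -
  have "card (near_peaks k) = (\<Sum>h=1..k. totient h * (2 * (k div h)))"
  proof -
    have "card (totatives h \<times> {- int (k div h)<..int (k div h)}) = totient h * (2 * (k div h))" for h
    proof -
      have "nat (int m - - int m) = 2 * m" for m by arith
      thus ?thesis by (simp only: card_cartesian_product totient_def card_greaterThanAtMost_int)
    qed
    thus ?thesis unfolding near_peaks_def by (subst card_SigmaI) auto
  qed
  also have "\<dots> = 2 * (\<Sum>h=1..k. totient h * (k div h))"
    by (simp add: sum_distrib_left algebra_simps)
  finally show ?thesis by (simp only: sum_totient_div)
qed

text \<open>This compares with \<open>0 / 1\<close> and \<open>1 / 1\<close>, whose peaks are 0 and
  \<open>k^2 + k\<close>. All positions lie in a half-open window of one period, so distinct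
  positions stay distinct modulo the period.\<close>

lemma near_peak_pos_bounds:
  assumes "x \<in> near_peaks k"
  shows "int k < near_peak_pos k x" "near_peak_pos k x \<le> int (k^2 + k) + int k"
proof -
  obtain h j t where x: "x = (h, j, t)" by (cases x)
  have h: "h \<ge> 1" "h \<le> k" and j: "0 < j" "j \<le> h" "coprime j h"
    and t: "- (int k div int h) < t" "t \<le> int k div int h"
    using assms by (auto simp: x near_peaks_def in_totatives_iff zdiv_int)
  show "int k < near_peak_pos k x"
    using peak_diff_ge[of 1 "int h" 0 "int j" k] h j t
    by (simp add: x near_peak_pos_def peak_zero)
  show "near_peak_pos k x \<le> int (k^2 + k) + int k"
  proof (cases "j = h")
    case True
    hence "h = 1" using j by simp
    thus ?thesis using True t peak_one[of k] by (simp add: x near_peak_pos_def)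
  next
    case False
    thus ?thesis
      using peak_diff_ge[of "int h" 1 "int j" 1 k] h j t peak_one[of k]
      by (simp add: x near_peak_pos_def)
  qed
qed

text \<open>By \<open>peak_diff_ge\<close> the peaks of distinct fractions are at least the sum of
  the two radii apart, so the half-open intervals are disjoint. Equal reduced fractions have equal
  numerator and denominator.\<close>

lemma inj_on_near_peak_pos: "inj_on (near_peak_pos k) (near_peaks k)"
proof (rule inj_onI)
  fix x y assume xy: "x \<in> near_peaks k" "y \<in> near_peaks k" "near_peak_pos k x = near_peak_pos k y"
  obtain h j t where x: "x = (h, j, t)" by (cases x)
  obtain h' j' t' where y: "y = (h', j', t')" by (cases y)
  have h: "h \<ge> 1" "h \<le> k" and j: "0 < j" "coprime j h"
    and t: "- (int k div int h) < t" "t \<le> int k div int h"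
    using xy by (auto simp: x near_peaks_def in_totatives_iff zdiv_int)
  have h': "h' \<ge> 1" "h' \<le> k" and j': "0 < j'" "coprime j' h'"
    and t': "- (int k div int h') < t'" "t' \<le> int k div int h'"
    using xy by (auto simp: y near_peaks_def in_totatives_iff zdiv_int)
  have eq: "peak k h j + t = peak k h' j' + t'" using xy(3) by (simp add: x y near_peak_pos_def)
  have "int j * int h' = int j' * int h"
  proof (rule ccontr)
    assume "int j * int h' \<noteq> int j' * int h"
    then consider "int j * int h' < int j' * int h" | "int j' * int h < int j * int h'" by linarith
    thus False
    proof cases
      case 1
      from peak_diff_ge[OF _ _ this, of k] show False using h h' t t' eq by simp
    next
      case 2
      from peak_diff_ge[OF _ _ this, of k] show False using h h' t t' eq by simp
    qed
  qed
  hence "j * h' = j' * h" by (metis of_nat_eq_iff of_nat_mult)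
  moreover have "h = h'"
  proof (rule dvd_antisym)
    have "h dvd j * h'" by (simp add: \<open>j * h' = j' * h\<close>)
    thus "h dvd h'" using j(2) by (simp add: coprime_dvd_mult_right_iff coprime_commute)
    have "h' dvd j' * h" by (simp flip: \<open>j * h' = j' * h\<close>)
    thus "h' dvd h" using j'(2) by (simp add: coprime_dvd_mult_right_iff coprime_commute)
  qed
  ultimately have "h = h'" "j = j'" using h by auto
  thus "x = y" using eq by (simp add: x y)
qed

lemma nullN_near_peak:
  assumes k: "k \<ge> 1" and x: "(h, j, t) \<in> near_peaks k"
    and n: "[int (n + k) = near_peak_pos k (h, j, t)] (mod int (k^2 + k))"
  shows "nullN n k = k div h - nat \<bar>t\<bar>"
proof -
  have h: "0 < h" "h \<le> k" and j: "coprime (int j) (int h)" and t: "\<bar>t\<bar> \<le> int (k div h)"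
    using x by (auto simp: near_peaks_def in_totatives_iff)
  \<comment> \<open>For \<open>n \<le> k\<close> the nullity is read off one period later, where the
    same congruence holds.\<close>
  have "[int (n + (k^2 + k) + k) = peak k h j + t] (mod int (k^2 + k))"
  proof -
    have "int (n + (k^2 + k) + k) = int (n + k) + int (k^2 + k)" by simp
    thus ?thesis using n by (simp only: near_peak_pos_def cong_def mod_add_self2 prod.case)
  qed
  thus ?thesis
    using kernel_dim_toepA_near_peak[OF k h j t] n
    by (simp add: nullN_def near_peak_pos_def)
qed

text \<open>Sending a position to its residue, shifted by \<open>- k\<close>, is injective, and
  there are as many triples as residues. Hence every residue is hit exactly once.\<close>

lemma card_nullN_eq:
  assumes k: "k \<ge> 1"
  shows "card {n \<in> {0..<k^2 + k}. nullN n k = z}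
    = card {(h, j, t) \<in> near_peaks k. k div h - nat \<bar>t\<bar> = z}"
proof -
  let ?L = "k^2 + k"
  let ?X = "near_peaks k"
  define f where "f x = nat ((near_peak_pos k x - int k) mod int ?L)" for x
  have L: "int ?L > 0" using period_pos[OF k] .
  have f_int: "int (f x) = (near_peak_pos k x - int k) mod int ?L" for x
    using pos_mod_sign[OF L] by (simp only: f_def nat_0_le)
  have f_less: "f x < ?L" for x
    using pos_mod_bound[OF L, of "near_peak_pos k x - int k"] f_int[of x] by linarith
  have inj: "inj_on f ?X"
  proof (rule inj_onI)
    fix x y assume xy: "x \<in> ?X" "y \<in> ?X" "f x = f y"
    have "[near_peak_pos k x - int k = near_peak_pos k y - int k] (mod int ?L)"
      using f_int[of x] f_int[of y] xy(3) by (simp only: cong_def)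
    hence "int ?L dvd near_peak_pos k x - near_peak_pos k y"
      unfolding cong_iff_dvd_diff by simp
    moreover have "\<bar>near_peak_pos k x - near_peak_pos k y\<bar> < int ?L"
      using near_peak_pos_bounds[OF xy(1)] near_peak_pos_bounds[OF xy(2)] by linarith
    ultimately have "near_peak_pos k x = near_peak_pos k y"
      by (metis dvd_imp_le_int eq_iff_diff_eq_0 abs_of_nat not_le)
    thus "x = y" using inj_on_near_peak_pos xy(1,2) by (auto dest: inj_onD)
  qed
  have img: "f ` ?X = {0..<?L}"
    by (rule card_subset_eq) (use f_less in \<open>auto simp: card_image[OF inj] card_near_peaks\<close>)
  have null: "nullN (f (h, j, t)) k = k div h - nat \<bar>t\<bar>" if "(h, j, t) \<in> ?X" for h j t
  proof (rule nullN_near_peak[OF k that])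
    have "[int (f (h, j, t)) + int k = (near_peak_pos k (h, j, t) - int k) + int k] (mod int ?L)"
      unfolding f_int by (intro cong_add cong_refl) (simp add: cong_def)
    thus "[int (f (h, j, t) + k) = near_peak_pos k (h, j, t)] (mod int ?L)" by simp
  qed
  have "{n \<in> {0..<?L}. nullN n k = z} = f ` {(h, j, t) \<in> ?X. k div h - nat \<bar>t\<bar> = z}"
    unfolding img[symmetric] by (auto simp: null)
  moreover have "inj_on f {(h, j, t) \<in> ?X. k div h - nat \<bar>t\<bar> = z}"
    by (rule inj_on_subset[OF inj]) auto
  ultimately show ?thesis by (simp add: card_image)
qed

section \<open>Counting the offsets with a given nullity\<close>

lemma sum_totient_if_le_div:
  assumes "z \<ge> 1"
  shows "(\<Sum>h=1..k. totient h * (if z \<le> k div h then 1 else 0)) = totient_sum (k div z)"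
proof -
  have "(\<Sum>h=1..k. totient h * (if z \<le> k div h then 1 else 0))
      = (\<Sum>h\<in>{h \<in> {1..k}. z \<le> k div h}. totient h)"
    by (subst sum.inter_filter) (auto intro!: sum.cong)
  also have "{h \<in> {1..k}. z \<le> k div h} = {h \<in> {1..k}. h * z \<le> k}"
    by (rule Collect_cong) (auto simp: less_eq_div_iff_mult_less_eq mult.commute)
  also have "\<dots> = {1..k div z}" using assms by (rule Collect_mult_le_eq)
  finally show ?thesis by (simp add: totient_sum_def)
qed

text \<open>The solutions are \<open>t = G - z\<close> and \<open>t = z - G\<close>, which coincide
  for \<open>z = G\<close>. Written as two indicators, the count yields two totient sums.\<close>

lemma card_offsets:
  fixes G z :: nat
  assumes "z \<ge> 1"
  shows "card {t \<in> {- int G<..int G}. G - nat \<bar>t\<bar> = z}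
    = (if z \<le> G then 1 else 0) + (if z + 1 \<le> G then 1 else 0)"
proof -
  have "{t \<in> {- int G<..int G}. G - nat \<bar>t\<bar> = z}
      = (if z \<le> G then {int G - int z, int z - int G} else {})"
  proof -
    have "- int G < t \<and> t \<le> int G \<and> G - nat \<bar>t\<bar> = z \<longleftrightarrow> z \<le> G \<and> (t = int G - int z \<or> t = int z - int G)"
      for t using assms by arith
    thus ?thesis by auto
  qed
  thus ?thesis by (auto simp: card_insert_if)
qed

lemma card_nullN_eq_totient_sum:
  assumes k: "k \<ge> 1" and z: "z \<ge> 1"
  shows "card {n \<in> {0..<k^2 + k}. nullN n k = z} = totient_sum (k div z) + totient_sum (k div (z + 1))"
proof -
  let ?A = "\<lambda>h. totatives h \<times> {t \<in> {- int (k div h)<..int (k div h)}. k div h - nat \<bar>t\<bar> = z}"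
  have set: "{(h, j, t) \<in> near_peaks k. k div h - nat \<bar>t\<bar> = z}
      = Sigma {1..k} ?A"
    by (auto simp: near_peaks_def)
  have "card (Sigma {1..k} ?A) = (\<Sum>h=1..k. totient h * ((if z \<le> k div h then 1 else 0) + (if z + 1 \<le> k div h then 1 else 0)))"
  proof (subst card_SigmaI)
    show "finite {1..k}" by simp
    have "finite {t \<in> {- int m<..int m}. m - nat \<bar>t\<bar> = z}" for m
      by (rule finite_subset[of _ "{- int m<..int m}"]) auto
    thus "\<forall>h\<in>{1..k}. finite (?A h)"
      by (intro ballI finite_cartesian_product) auto
    show "(\<Sum>h=1..k. card (?A h))
      = (\<Sum>h=1..k. totient h * ((if z \<le> k div h then 1 else 0) + (if z + 1 \<le> k div h then 1 else 0)))"
      by (rule sum.cong[OF refl], subst card_cartesian_product, subst card_offsets[OF z], subst totient_def, rule refl)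
  qed
  also have "\<dots> = totient_sum (k div z) + totient_sum (k div (z + 1))"
    unfolding distrib_left sum.distrib by (simp only: sum_totient_if_le_div[OF z] sum_totient_if_le_div[of "z + 1"] le_add2)
  finally show ?thesis unfolding card_nullN_eq[OF k] set .
qed

section \<open>The summatory function of the totient\<close>

text \<open>Both this sum and the one in \<open>sum_totient_div\<close> run over the pairs with
  \<open>h * d \<le> k\<close>, weighted by \<open>totient h\<close>.\<close>

lemma sum_totient_sum_div: "2 * (\<Sum>d=1..k. totient_sum (k div d)) = k^2 + k"
proof -
  have "(\<Sum>d=1..k. totient_sum (k div d)) = (\<Sum>d=1..k. \<Sum>h=1..k. if h * d \<le> k then totient h else 0)"
  proof (rule sum.cong[OF refl])
    fix d assume d: "d \<in> {1..k}"
    have "{h \<in> {1..k}. h * d \<le> k} = {1..k div d}"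
      using d by (intro Collect_mult_le_eq) simp
    moreover have "(\<Sum>h=1..k. if h * d \<le> k then totient h else 0) = (\<Sum>h\<in>{h \<in> {1..k}. h * d \<le> k}. totient h)"
      by (rule sum.inter_filter[symmetric]) simp
    ultimately show "totient_sum (k div d) = (\<Sum>h=1..k. if h * d \<le> k then totient h else 0)"
      by (simp only: totient_sum_def)
  qed
  also have "\<dots> = (\<Sum>h=1..k. \<Sum>d=1..k. if h * d \<le> k then totient h else 0)"
    by (rule sum.swap)
  also have "\<dots> = (\<Sum>h=1..k. totient h * (k div h))"
  proof (rule sum.cong[OF refl])
    fix h assume h: "h \<in> {1..k}"
    have "{d \<in> {1..k}. h * d \<le> k} = {1..k div h}"
      using Collect_mult_le_eq[of h k] h by (simp add: mult.commute)
    moreover have "(\<Sum>d=1..k. if h * d \<le> k then totient h else 0) = (\<Sum>d\<in>{d \<in> {1..k}. h * d \<le> k}. totient h)"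
      by (rule sum.inter_filter[symmetric]) simp
    ultimately show "(\<Sum>d=1..k. if h * d \<le> k then totient h else 0) = totient h * (k div h)"
      by simp
  qed
  finally show ?thesis using sum_totient_div[of k] by simp
qed

text \<open>This crude bound starts the error iteration in \<open>totient_sum_asymp\<close>.\<close>

lemma totient_sum_le: "totient_sum m \<le> m^2"
proof -
  have "totient_sum m \<le> (\<Sum>h=1..m. m)"
    unfolding totient_sum_def
  proof (rule sum_mono)
    show "totient h \<le> m" if "h \<in> {1..m}" for h using totient_le[of h] that by simp
  qed
  thus ?thesis by (simp add: power2_eq_square)
qed

section \<open>Limits of sums over the quotients \<open>k div d\<close>\<close>

lemma real_nat_div_bounds:
  fixes k d :: nat
  shows "real (k div d) \<le> real k / real d" "real k / real d - 1 \<le> real (k div d)"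
  using floor_correct[of "real k / real d"] unfolding floor_divide_of_nat_eq by auto

lemma tendsto_div_over_nat:
  assumes "d \<ge> 1"
  shows "(\<lambda>k. real (k div d) / real k) \<longlonglongrightarrow> 1 / real d"
proof (rule tendsto_sandwich[of "\<lambda>k. 1 / real d - 1 / real k" _ _ "\<lambda>_. 1 / real d"])
  show "eventually (\<lambda>k. 1 / real d - 1 / real k \<le> real (k div d) / real k) sequentially"
    using eventually_gt_at_top[of 0]
  proof eventually_elim
    case (elim k)
    have "1 / real d - 1 / real k = (real k / real d - 1) / real k" using elim by (simp add: field_simps)
    also have "\<dots> \<le> real (k div d) / real k" by (intro divide_right_mono real_nat_div_bounds) auto
    finally show ?case .
  qed
  show "eventually (\<lambda>k. real (k div d) / real k \<le> 1 / real d) sequentially"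
    using eventually_gt_at_top[of 0]
  proof eventually_elim
    case (elim k)
    have "real (k div d) / real k \<le> (real k / real d) / real k" by (intro divide_right_mono real_nat_div_bounds) auto
    thus ?case using elim by simp
  qed
  show "(\<lambda>k. 1 / real d - 1 / real k) \<longlonglongrightarrow> 1 / real d"
    using tendsto_diff[OF tendsto_const[of "1 / real d"] lim_1_over_n] by simp
qed simp

text \<open>Each term tends to \<open>1 / d^2\<close> and is dominated by it, so Tannery's theorem
  gives the Basel sum. The terms with \<open>d > k\<close> are 0, so the finite sum is a full
  series.\<close>

lemma tendsto_sum_div_squares:
  "(\<lambda>k. (\<Sum>d=1..k. (real (k div d) / real k)^2)) \<longlonglongrightarrow> pi^2 / 6"
proof -
  let ?a = "\<lambda>i k. (real (k div (i + 1)) / real k)^2"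
  let ?M = "\<lambda>i. 1 / (real i + 1)^2"
  have sums: "?M sums (pi\<^sup>2 / 6)" using inverse_squares_sums by (simp add: add.commute)
  have bound: "norm (?a i k) \<le> ?M i" for i k
  proof (cases "k = 0")
    case False
    have "real (k div (i + 1)) / real k \<le> (real k / real (i + 1)) / real k"
      by (intro divide_right_mono) (rule real_nat_div_bounds, simp)
    also have "\<dots> = 1 / (real i + 1)" using False by simp
    finally have "?a i k \<le> (1 / (real i + 1))^2" by (intro power_mono) auto
    thus ?thesis by (simp add: power_divide)
  qed simp
  have "(\<lambda>k. \<Sum>i. ?a i k) \<longlonglongrightarrow> (\<Sum>i. (1 / real (i + 1))^2)"
  proof (rule tannerys_theorem[THEN conjunct2, THEN conjunct2])
    show "(\<lambda>k. ?a i k) \<longlonglongrightarrow> (1 / real (i + 1))^2" for i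
      by (intro tendsto_power tendsto_div_over_nat) simp
    show "\<forall>\<^sub>F (i, k) in sequentially \<times>\<^sub>F sequentially. norm (?a i k) \<le> ?M i"
      using bound by (intro always_eventually) auto
    show "summable ?M" using sums by (rule sums_summable)
  qed simp
  moreover have "(\<Sum>i. ?a i k) = (\<Sum>d=1..k. (real (k div d) / real k)^2)" for k
  proof -
    have "(\<Sum>i. ?a i k) = (\<Sum>i<k. ?a i k)"
      by (rule suminf_finite) (auto simp: not_less)
    also have "\<dots> = (\<Sum>d=1..k. (real (k div d) / real k)^2)"
      by (rule sum.reindex_bij_witness[of _ "\<lambda>d. d - 1" "\<lambda>i. i + 1"]) auto
    finally show ?thesis .
  qed
  moreover have "(\<Sum>i. (1 / real (i + 1))^2) = pi^2 / 6"
    using sums by (simp add: sums_iff power_divide add.commute)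
  ultimately show ?thesis by (simp only:)
qed

text \<open>The term \<open>1 / 4\<close> is kept, and each later \<open>1 / d^2\<close> is at most
  \<open>1 / (d - 1) - 1 / d\<close>, which telescopes to at most \<open>1 / 2\<close>.\<close>

lemma sum_inverse_squares_from_2_le: "(\<Sum>d=2..k. 1 / real d ^ 2) \<le> 3 / 4"
proof -
  have "(\<Sum>d=2..m+2. 1 / real d ^ 2) \<le> 3 / 4 - 1 / (real m + 2)" for m
  proof (induction m)
    case (Suc m)
    have "1 / (real m + 3)^2 \<le> 1 / ((real m + 2) * (real m + 3))"
      by (intro divide_left_mono) (auto simp: power2_eq_square intro!: mult_right_mono)
    also have "\<dots> = 1 / (real m + 2) - 1 / (real m + 3)" by (simp add: field_simps)
    finally have "1 / (real m + 3)^2 \<le> 1 / (real m + 2) - 1 / (real m + 3)" .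
    thus ?case using Suc by (simp add: add.commute)
  qed simp
  note * = this
  show ?thesis
  proof (cases "k \<ge> 2")
    case True
    then obtain m where "k = m + 2" by (metis add.commute le_Suc_ex)
    hence "(\<Sum>d=2..k. 1 / real d ^ 2) \<le> 3 / 4 - 1 / (real m + 2)" using *[of m] by simp
    also have "\<dots> \<le> 3 / 4" by simp
    finally show ?thesis .
  qed simp
qed

text \<open>Removing the term \<open>d = 1\<close> from the identity for the sum of \<open>totient_sum (k div d)\<close>
  expresses the error at \<open>k\<close> through the errors at \<open>k div d\<close> for \<open>d \<ge> 2\<close>.
  This is a contraction, because the sum of \<open>1 / d^2\<close> over \<open>d \<ge> 2\<close> is less than 1.\<close>

lemma totient_sum_asymp: "(\<lambda>m. real (totient_sum m) / real m ^ 2) \<longlonglongrightarrow> 3 / pi^2"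
proof -
  define c where "c = 3 / pi^2"
  define err where "err m = real (totient_sum m) - c * real m ^ 2" for m
  \<comment> \<open>For \<open>k \<ge> 1\<close> this is the sum of \<open>err (k div d)\<close>
    over all \<open>d\<close> from 1 to \<open>k\<close>. It is of smaller order than
    \<open>k^2\<close> because \<open>c * (pi^2 / 6) = 1 / 2\<close>, which determines
    \<open>c\<close>.\<close>
  define R where "R k = (real k ^ 2 + real k) / 2 - c * (\<Sum>d=1..k. real (k div d) ^ 2)" for k
  have c0: "c \<ge> 0" by (simp add: c_def)
  have err_bound: "\<bar>err m\<bar> \<le> (1 + c) * real m ^ 2" for m
  proof -
    have "real (totient_sum m) \<le> real m ^ 2" using totient_sum_le[of m] by (metis of_nat_le_iff of_nat_power)
    moreover have "0 \<le> c * real m ^ 2" using c0 by simp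
    moreover have "(1 + c) * real m ^ 2 = real m ^ 2 + c * real m ^ 2" by (simp add: algebra_simps)
    ultimately show ?thesis unfolding err_def by linarith
  qed
  have rec: "err k = R k - (\<Sum>d=2..k. err (k div d))" if "k \<ge> 1" for k
  proof -
    have "2 * (\<Sum>d=1..k. real (totient_sum (k div d))) = real k ^ 2 + real k"
      using arg_cong[OF sum_totient_sum_div[of k], of real] by simp
    moreover have "(\<Sum>d=1..k. err (k div d))
        = (\<Sum>d=1..k. real (totient_sum (k div d))) - c * (\<Sum>d=1..k. real (k div d) ^ 2)"
      by (simp add: err_def sum_subtractf sum_distrib_left)
    ultimately have "(\<Sum>d=1..k. err (k div d)) = R k" by (simp add: R_def)
    moreover have "{1..k} = insert 1 {2..k}" using that by auto
    ultimately show ?thesis by simp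
  qed
  have R_lim: "(\<lambda>k. R k / real k ^ 2) \<longlonglongrightarrow> 0"
  proof -
    have "(\<lambda>k. 1 / 2 + 1 / real k / 2 - c * (\<Sum>d=1..k. (real (k div d) / real k)^2)) \<longlonglongrightarrow> 1 / 2 + 0 / 2 - c * (pi^2 / 6)"
      by (intro tendsto_intros tendsto_sum_div_squares lim_1_over_n) simp
    hence "(\<lambda>k. 1 / 2 + 1 / real k / 2 - c * (\<Sum>d=1..k. (real (k div d) / real k)^2)) \<longlonglongrightarrow> 0"
      by (simp add: c_def)
    thus ?thesis
    proof (rule Lim_transform_eventually)
      show "\<forall>\<^sub>F k in sequentially. 1 / 2 + 1 / real k / 2 - c * (\<Sum>d=1..k. (real (k div d) / real k)^2) = R k / real k ^ 2"
        using eventually_gt_at_top[of 0]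
      proof eventually_elim
        case (elim k)
        have "(\<Sum>d=1..k. (real (k div d) / real k)^2) = (\<Sum>d=1..k. real (k div d) ^ 2) / real k ^ 2"
          by (simp add: power_divide sum_divide_distrib)
        thus ?case using elim by (simp add: R_def field_simps power2_eq_square)
      qed
    qed
  qed
  \<comment> \<open>The factor is \<open>7 / 8 = 3 / 4 + 1 / 8\<close>: the terms with
    \<open>d \<ge> 2\<close> contribute \<open>3 / 4\<close>, and the remaining \<open>1 / 8\<close>
    absorbs \<open>R k\<close> and a linear term.\<close>
  have step: "eventually (\<lambda>k. \<bar>err k\<bar> \<le> 7 / 8 * g * real k ^ 2) sequentially"
    if g: "g > 0" and ev: "eventually (\<lambda>k. \<bar>err k\<bar> \<le> g * real k ^ 2) sequentially" for g
  proof -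
    obtain K where K: "\<And>m. m \<ge> K \<Longrightarrow> \<bar>err m\<bar> \<le> g * real m ^ 2"
      using ev by (auto simp: eventually_at_top_linorder)
    define C where "C = (1 + c) * real K ^ 2"
    have C0: "C \<ge> 0" using c0 by (simp add: C_def)
    have each: "\<bar>err m\<bar> \<le> g * real m ^ 2 + C" for m
    proof (cases "m \<ge> K")
      case False
      hence "real m ^ 2 \<le> real K ^ 2" by (intro power_mono) auto
      hence "(1 + c) * real m ^ 2 \<le> C" unfolding C_def using c0 by (intro mult_left_mono) auto
      moreover have "0 \<le> g * real m ^ 2" using g by simp
      ultimately show ?thesis using err_bound[of m] by linarith
    qed (use K[of m] C0 in linarith)
    have main: "\<bar>err k\<bar> \<le> \<bar>R k\<bar> + 3 / 4 * g * real k ^ 2 + C * real k" if "k \<ge> 1" for k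
    proof -
      have "\<bar>\<Sum>d=2..k. err (k div d)\<bar> \<le> (\<Sum>d=2..k. \<bar>err (k div d)\<bar>)" by (rule sum_abs)
      also have "\<dots> \<le> (\<Sum>d=2..k. g * real k ^ 2 * (1 / real d ^ 2) + C)"
      proof (rule sum_mono)
        fix d assume "d \<in> {2..k}"
        have "real (k div d) ^ 2 \<le> (real k / real d) ^ 2"
          by (intro power_mono real_nat_div_bounds) simp
        hence "g * real (k div d) ^ 2 \<le> g * (real k / real d) ^ 2" using g by (intro mult_left_mono) auto
        thus "\<bar>err (k div d)\<bar> \<le> g * real k ^ 2 * (1 / real d ^ 2) + C"
          using each[of "k div d"] by (simp add: power_divide)
      qed
      also have "\<dots> = g * real k ^ 2 * (\<Sum>d=2..k. 1 / real d ^ 2) + real (card {2..k}) * C"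
        by (simp add: sum.distrib sum_distrib_left)
      also have "\<dots> \<le> g * real k ^ 2 * (3 / 4) + real k * C"
        using g C0 by (intro add_mono mult_left_mono mult_right_mono sum_inverse_squares_from_2_le) auto
      finally show ?thesis using rec[OF that] by (simp add: algebra_simps)
    qed
    have "(\<lambda>k. \<bar>R k / real k ^ 2\<bar> + C * (1 / real k)) \<longlonglongrightarrow> \<bar>0\<bar> + C * 0"
      by (intro tendsto_intros R_lim lim_1_over_n)
    hence "eventually (\<lambda>k. \<bar>R k / real k ^ 2\<bar> + C * (1 / real k) < g / 8) sequentially"
      using g by (intro order_tendstoD) auto
    thus ?thesis using eventually_gt_at_top[of 0]
    proof eventually_elim
      case (elim k)
      have "(\<bar>R k / real k ^ 2\<bar> + C * (1 / real k)) * real k ^ 2 \<le> g / 8 * real k ^ 2"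
        using elim by (intro mult_right_mono) auto
      moreover have "(\<bar>R k / real k ^ 2\<bar> + C * (1 / real k)) * real k ^ 2 = \<bar>R k\<bar> + C * real k"
        using elim by (simp add: field_simps power2_eq_square)
      ultimately have "\<bar>R k\<bar> + C * real k \<le> g / 8 * real k ^ 2" by linarith
      moreover have "\<bar>err k\<bar> \<le> \<bar>R k\<bar> + 3 / 4 * g * real k ^ 2 + C * real k"
        using elim by (intro main) simp
      ultimately show ?case by linarith
    qed
  qed
  have iter: "eventually (\<lambda>k. \<bar>err k\<bar> \<le> (7 / 8) ^ i * (1 + c) * real k ^ 2) sequentially" for i
  proof (induction i)
    case 0
    show ?case using err_bound by simp
  next
    case (Suc i)
    have "0 < (7 / 8) ^ i * (1 + c)" using c0 by simp
    from step[OF this Suc] show ?case by (simp add: mult.assoc)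
  qed
  have "(\<lambda>m. err m / real m ^ 2) \<longlonglongrightarrow> 0"
  proof (rule LIMSEQ_I, goal_cases)
    case (1 r)
    have "(\<lambda>i. (7 / 8) ^ i * (1 + c)) \<longlonglongrightarrow> 0 * (1 + c)"
      by (intro tendsto_intros LIMSEQ_realpow_zero) auto
    hence "eventually (\<lambda>i. (7 / 8) ^ i * (1 + c) < r) sequentially"
      using 1 by (intro order_tendstoD) auto
    then obtain i where i: "(7 / 8) ^ i * (1 + c) < r" by (auto simp: eventually_at_top_linorder)
    have "eventually (\<lambda>m. norm (err m / real m ^ 2 - 0) < r) sequentially"
      using iter[of i] eventually_gt_at_top[of 0]
    proof eventually_elim
      case (elim m)
      have "\<bar>err m / real m ^ 2\<bar> = \<bar>err m\<bar> / real m ^ 2" by simp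
      also have "\<dots> \<le> (7 / 8) ^ i * (1 + c)" using elim by (simp add: divide_le_eq)
      finally show ?case using i by simp
    qed
    thus ?case by (simp add: eventually_at_top_linorder)
  qed
  from tendsto_add[OF this tendsto_const[of c]]
  have "(\<lambda>m. err m / real m ^ 2 + c) \<longlonglongrightarrow> c" by simp
  moreover have "\<forall>\<^sub>F m in sequentially. err m / real m ^ 2 + c = real (totient_sum m) / real m ^ 2"
    using eventually_gt_at_top[of 0]
    by eventually_elim (simp add: err_def field_simps)
  ultimately show ?thesis unfolding c_def by (rule Lim_transform_eventually)
qed

text \<open>The ratio is split into the known ratio at \<open>k div z\<close>, the square of
  \<open>(k div z) / k\<close>, and \<open>k^2 / (k^2 + k)\<close>. From \<open>k \<ge> z\<close> on
  the inner denominator is nonzero.\<close>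

lemma totient_sum_div_asymp:
  assumes "z \<ge> 1"
  shows "(\<lambda>k. real (totient_sum (k div z)) / real (k^2 + k)) \<longlonglongrightarrow> 3 / pi^2 * (1 / real z ^ 2)"
proof -
  have "filterlim (\<lambda>k. k div z) at_top sequentially"
    unfolding filterlim_at_top
  proof
    fix m
    show "\<forall>\<^sub>F k in sequentially. m \<le> k div z"
      using eventually_ge_at_top[of "m * z"]
      by eventually_elim (use assms in \<open>simp add: less_eq_div_iff_mult_less_eq\<close>)
  qed
  from filterlim_compose[OF totient_sum_asymp this]
  have "(\<lambda>k. real (totient_sum (k div z)) / real (k div z) ^ 2) \<longlonglongrightarrow> 3 / pi^2" .
  moreover have "(\<lambda>k. 1 / (1 + 1 / real k)) \<longlonglongrightarrow> 1 / (1 + 0)"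
    by (intro tendsto_intros lim_1_over_n) simp
  ultimately have "(\<lambda>k. real (totient_sum (k div z)) / real (k div z) ^ 2 * (real (k div z) / real k)^2
      * (1 / (1 + 1 / real k))) \<longlonglongrightarrow> 3 / pi^2 * (1 / real z)^2 * (1 / (1 + 0))"
    by (intro tendsto_mult tendsto_power tendsto_div_over_nat assms)
  hence "(\<lambda>k. real (totient_sum (k div z)) / real (k div z) ^ 2 * (real (k div z) / real k)^2
      * (1 / (1 + 1 / real k))) \<longlonglongrightarrow> 3 / pi^2 * (1 / real z ^ 2)"
    by (simp add: power_divide)
  thus ?thesis
  proof (rule Lim_transform_eventually)
    show "\<forall>\<^sub>F k in sequentially. real (totient_sum (k div z)) / real (k div z) ^ 2
        * (real (k div z) / real k)^2 * (1 / (1 + 1 / real k)) = real (totient_sum (k div z)) / real (k^2 + k)"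
      using eventually_ge_at_top[of z]
    proof eventually_elim
      case (elim k)
      have pos: "k div z > 0" "k > 0" using elim assms by (auto simp: div_greater_zero_iff)
      have "real (k div z) \<noteq> 0" using pos(1) by linarith
      hence "real (totient_sum (k div z)) / real (k div z) ^ 2 * (real (k div z) / real k)^2
          = real (totient_sum (k div z)) / real k ^ 2"
        by (simp add: power_divide)
      moreover have "1 / (1 + 1 / real k) = real k / (real k + 1)"
        using pos by (simp add: field_simps)
      moreover have "real (k^2 + k) = real k * (real k + 1)"
        by (simp add: power2_eq_square algebra_simps)
      ultimately show ?case using pos by (simp add: power2_eq_square)
    qed
  qed
qed

theorem theorem8p2:
  fixes z :: nat
  assumes "z \<ge> 1"
  shows "(\<lambda>k. propP z k) \<longlonglongrightarrow> 3 / pi^2 * (1 / real z ^ 2 + 1 / real (z + 1) ^ 2)"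
proof -
  have "(\<lambda>k. real (totient_sum (k div z)) / real (k^2 + k)
      + real (totient_sum (k div (z + 1))) / real (k^2 + k))
    \<longlonglongrightarrow> 3 / pi^2 * (1 / real z ^ 2) + 3 / pi^2 * (1 / real (z + 1) ^ 2)"
    using assms by (intro tendsto_add totient_sum_div_asymp) simp_all
  hence "(\<lambda>k. real (totient_sum (k div z)) / real (k^2 + k)
      + real (totient_sum (k div (z + 1))) / real (k^2 + k))
    \<longlonglongrightarrow> 3 / pi^2 * (1 / real z ^ 2 + 1 / real (z + 1) ^ 2)"
    by (simp only: distrib_left)
  moreover have "\<forall>\<^sub>F k in sequentially. real (totient_sum (k div z)) / real (k^2 + k)
      + real (totient_sum (k div (z + 1))) / real (k^2 + k) = propP z k"
    using eventually_ge_at_top[of 1]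
    by eventually_elim
       (simp only: propP_def card_nullN_eq_totient_sum[OF _ assms] of_nat_add[of "totient_sum _"] add_divide_distrib)
  ultimately show ?thesis by (rule Lim_transform_eventually)
qed

end
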